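(* Let $p\in\mathbb{N}$ and let $J$ be the periodic Jacobi operator on $\ell^2(\mathbb{Z})$ with real $p$-periodic coefficient sequences $a=\{a_i\}_{i\in\mathbb{Z}}$, $b=\{b_i\}_{i\in\mathbb{Z}}$, $c=\{c_i\}_{i\in\mathbb{Z}}$. If $b_0=b_1=\cdots=b_{p-1}$ and $c_0=c_1=\cdots=c_{p-1}$, then $\Lambda_{3\omega_{a_0}}(J)$ is path-connected.
   Context: For real sequences $a,b,c$ indexed by $\mathbb{Z}$ with $a_{i+p}=a_i$, $b_{i+p}=b_i$, $c_{i+p}=c_i$ for all $i$, the periodic Jacobi operator $J$ is the bounded (in general non-normal) linear operator on the complex Hilbert space $\ell^2(\mathbb{Z})$ given by the tridiagonal matrix with $$(Ju)_n=c_{n-1}u_{n-1}+a_nu_n+b_nu_{n+1},\qquad n\in\mathbb{Z}.$$ For a bounded operator $A$ on a complex Hilbert space with spectrum $\sigma(A)$ and $\epsilon>0$, the $\epsilon$-pseudospectrum is $$\Lambda_\epsilon(A)=\sigma(A)\cup\{z\in\mathbb{C}:\ z\notin\sigma(A),\ \|(zI-A)^{-1}\|\ge \epsilon^{-1}\},$$ and $\Lambda_0(A)=\sigma(A)$. Notation: $\omega_{a_0}=\max\{|a_i-a_0|: i=0,1,2,\ldots\}$. *)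

theory Defs
  imports "HOL-Analysis.Analysis"
begin

section \<open>Complex Hilbert spaces\<close>

text \<open>
  The real inner product of \<^class>\<open>real_inner\<close>, which induces the norm, is required to be the real
  part of the complex inner product; hence \<open>norm x = sqrt (Re (cinner x x))\<close>.  The inner product
  is linear in its second argument.
\<close>

class complex_hilbert = real_inner + complete_space +
  fixes scaleC :: "complex \<Rightarrow> 'a \<Rightarrow> 'a"
    and cinner :: "'a \<Rightarrow> 'a \<Rightarrow> complex"
  assumes scaleC_add_right: "scaleC z (x + y) = scaleC z x + scaleC z y"
    and scaleC_add_left: "scaleC (z + w) x = scaleC z x + scaleC w x"
    and scaleC_scaleC: "scaleC z (scaleC w x) = scaleC (z * w) x"
    and scaleC_of_real: "scaleC (complex_of_real r) x = scaleR r x"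
    and cinner_commute: "cinner x y = cnj (cinner y x)"
    and cinner_add_right: "cinner x (y + y') = cinner x y + cinner x y'"
    and cinner_scaleC_right: "cinner x (scaleC w y) = w * cinner x y"
    and Re_cinner: "Re (cinner x y) = inner x y"

section \<open>Spectrum and pseudospectrum of a bounded operator\<close>

definition bounded_clinear :: "('a::complex_hilbert \<Rightarrow> 'b::complex_hilbert) \<Rightarrow> bool" where
  "bounded_clinear A \<longleftrightarrow> bounded_linear A \<and> (\<forall>z x. A (scaleC z x) = scaleC z (A x))"

text \<open>The inverse is total in HOL; it is meaningful only where \<open>z I - A\<close> is bijective.\<close>

definition resolvent_op :: "('a::complex_hilbert \<Rightarrow> 'a) \<Rightarrow> complex \<Rightarrow> 'a \<Rightarrow> 'a" where
  "resolvent_op A z = inv (\<lambda>x. scaleC z x - A x)"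

definition op_spectrum :: "('a::complex_hilbert \<Rightarrow> 'a) \<Rightarrow> complex set" where
  "op_spectrum A =
    {z. \<not> (bij (\<lambda>x. scaleC z x - A x) \<and> bounded_clinear (resolvent_op A z))}"

text \<open>The case distinction is needed because \<open>1 / 0 = 0\<close>.  Only \<open>\<epsilon> \<ge> 0\<close> is meaningful.\<close>

definition pseudospectrum :: "real \<Rightarrow> ('a::complex_hilbert \<Rightarrow> 'a) \<Rightarrow> complex set" where
  "pseudospectrum \<epsilon> A =
    (if \<epsilon> > 0
     then op_spectrum A \<union> {z. z \<notin> op_spectrum A \<and> onorm (resolvent_op A z) \<ge> 1 / \<epsilon>}
     else op_spectrum A)"

section \<open>The Hilbert space of square-summable families\<close>

definition square_summable :: "('i \<Rightarrow> complex) \<Rightarrow> bool" where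
  "square_summable f \<longleftrightarrow> (\<lambda>i. (cmod (f i))\<^sup>2) summable_on UNIV"

lemma square_summable_0: "square_summable (\<lambda>_. 0)"
  by (simp add: square_summable_def)

lemma square_summable_add:
  assumes "square_summable f" "square_summable g"
  shows "square_summable (\<lambda>i. f i + g i)"
proof -
  have s: "(\<lambda>i. 2 * (cmod (f i))\<^sup>2 + 2 * (cmod (g i))\<^sup>2) summable_on UNIV"
    using assms unfolding square_summable_def
    by (intro summable_on_add summable_on_cmult_right) auto
  have b: "(cmod (f i + g i))\<^sup>2 \<le> 2 * (cmod (f i))\<^sup>2 + 2 * (cmod (g i))\<^sup>2" for i
  proof -
    have "(cmod (f i + g i))\<^sup>2 \<le> (cmod (f i) + cmod (g i))\<^sup>2"
      by (intro power_mono norm_triangle_ineq) auto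
    also have "\<dots> \<le> 2 * (cmod (f i))\<^sup>2 + 2 * (cmod (g i))\<^sup>2"
      using sum_squares_bound[of "cmod (f i)" "cmod (g i)"] by (simp add: power2_sum)
    finally show ?thesis .
  qed
  show ?thesis
    unfolding square_summable_def
    by (rule summable_on_comparison_test[OF s]) (use b in auto)
qed

lemma square_summable_bounded_mult:
  assumes "square_summable f" "\<And>i. cmod (d i) \<le> B"
  shows "square_summable (\<lambda>i. d i * f i)"
proof -
  have s: "(\<lambda>i. B\<^sup>2 * (cmod (f i))\<^sup>2) summable_on UNIV"
    using assms(1) unfolding square_summable_def by (intro summable_on_cmult_right)
  have b: "(cmod (d i * f i))\<^sup>2 \<le> B\<^sup>2 * (cmod (f i))\<^sup>2" for i
    unfolding norm_mult power_mult_distrib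
    by (intro mult_right_mono power_mono assms(2)) auto
  show ?thesis
    unfolding square_summable_def
    by (rule summable_on_comparison_test[OF s]) (use b in auto)
qed

lemma square_summable_cmult:
  assumes "square_summable f" shows "square_summable (\<lambda>i. z * f i)"
  using square_summable_bounded_mult[OF assms, of "\<lambda>_. z" "cmod z"] by simp

lemma square_summable_uminus:
  assumes "square_summable f" shows "square_summable (\<lambda>i. - f i)"
  using assms by (simp add: square_summable_def)

lemma square_summable_diff:
  assumes "square_summable f" "square_summable g"
  shows "square_summable (\<lambda>i. f i - g i)"
  using square_summable_add[OF assms(1) square_summable_uminus[OF assms(2)]] by simp

lemma square_summable_reindex:
  assumes "square_summable f" "bij h"
  shows "square_summable (\<lambda>i. f (h i))"
  using assms summable_on_reindex_bij_betw[of h UNIV UNIV "\<lambda>i. (cmod (f i))\<^sup>2"]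
  unfolding square_summable_def by simp

lemma square_summable_cinner:
  assumes "square_summable f" "square_summable g"
  shows "(\<lambda>i. cnj (f i) * g i) summable_on UNIV"
proof -
  have s: "(\<lambda>i. (cmod (f i))\<^sup>2 + (cmod (g i))\<^sup>2) summable_on UNIV"
    using assms unfolding square_summable_def by (intro summable_on_add)
  have b: "norm (cnj (f i) * g i) \<le> (cmod (f i))\<^sup>2 + (cmod (g i))\<^sup>2" for i
  proof -
    have "0 \<le> cmod (f i) * cmod (g i)" by simp
    then have "cmod (f i) * cmod (g i) \<le> (cmod (f i))\<^sup>2 + (cmod (g i))\<^sup>2"
      using sum_squares_bound[of "cmod (f i)" "cmod (g i)"] by linarith
    then show ?thesis by (simp add: norm_mult)
  qed
  have "(\<lambda>i. norm (cnj (f i) * g i)) summable_on UNIV"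
    by (rule summable_on_comparison_test[OF s]) (use b in auto)
  then show ?thesis by (rule abs_summable_summable)
qed

typedef 'i ell2 = "{f :: 'i \<Rightarrow> complex. square_summable f}"
  morphisms coord Abs_ell2
  using square_summable_0 by blast

lemma square_summable_coord [simp]: "square_summable (coord u)"
  using coord by auto

lemma coord_Abs_ell2: "square_summable f \<Longrightarrow> coord (Abs_ell2 f) = f"
  by (simp add: Abs_ell2_inverse)

lemma ell2_eqI: "(\<And>i. coord u i = coord v i) \<Longrightarrow> u = v"
  by (metis coord_inject ext)

instantiation ell2 :: (type) real_vector
begin

definition zero_ell2 :: "'a ell2" where "0 = Abs_ell2 (\<lambda>_. 0)"
definition plus_ell2 :: "'a ell2 \<Rightarrow> 'a ell2 \<Rightarrow> 'a ell2" where
  "u + v = Abs_ell2 (\<lambda>i. coord u i + coord v i)"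
definition minus_ell2 :: "'a ell2 \<Rightarrow> 'a ell2 \<Rightarrow> 'a ell2" where
  "u - v = Abs_ell2 (\<lambda>i. coord u i - coord v i)"
definition uminus_ell2 :: "'a ell2 \<Rightarrow> 'a ell2" where
  "- u = Abs_ell2 (\<lambda>i. - coord u i)"
definition scaleR_ell2 :: "real \<Rightarrow> 'a ell2 \<Rightarrow> 'a ell2" where
  "scaleR r u = Abs_ell2 (\<lambda>i. complex_of_real r * coord u i)"

lemma coord_vector_ops [simp]:
  "coord (0 :: 'a ell2) i = 0"
  "coord (u + v) i = coord u i + coord v i"
  "coord (u - v) i = coord u i - coord v i"
  "coord (- u) i = - coord u i"
  "coord (scaleR r u) i = complex_of_real r * coord u i"
  for u v :: "'a ell2"
  by (simp_all add: zero_ell2_def plus_ell2_def minus_ell2_def uminus_ell2_def scaleR_ell2_def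
      coord_Abs_ell2 square_summable_0 square_summable_add square_summable_diff
      square_summable_uminus square_summable_cmult)

instance
  by standard (auto intro!: ell2_eqI simp: algebra_simps)

end

definition l2_norm :: "'a ell2 \<Rightarrow> real" where
  "l2_norm u = sqrt (\<Sum>\<^sub>\<infinity>i. (cmod (coord u i))\<^sup>2)"

instantiation ell2 :: (type) real_inner
begin

definition inner_ell2 :: "'a ell2 \<Rightarrow> 'a ell2 \<Rightarrow> real" where
  "inner u v = Re (\<Sum>\<^sub>\<infinity>i. cnj (coord u i) * coord v i)"
definition norm_ell2 :: "'a ell2 \<Rightarrow> real" where
  "norm u = l2_norm u"
definition dist_ell2 :: "'a ell2 \<Rightarrow> 'a ell2 \<Rightarrow> real" where
  "dist u v = l2_norm (u - v)"
definition sgn_ell2 :: "'a ell2 \<Rightarrow> 'a ell2" where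
  "sgn u = u /\<^sub>R l2_norm u"
definition uniformity_ell2 :: "('a ell2 \<times> 'a ell2) filter" where
  "uniformity = (INF e\<in>{0<..}. principal {(u, v). l2_norm (u - v) < e})"
definition open_ell2 :: "'a ell2 set \<Rightarrow> bool" where
  "open U \<longleftrightarrow> (\<forall>u\<in>U. eventually (\<lambda>(u', v). u' = u \<longrightarrow> v \<in> U)
    (INF e\<in>{0<..}. principal {(u, v). l2_norm (u - v) < e}))"

lemma inner_ell2_self: "inner u u = (\<Sum>\<^sub>\<infinity>i. (cmod (coord u i))\<^sup>2)" for u :: "'a ell2"
proof -
  have "inner u u = (\<Sum>\<^sub>\<infinity>i. Re (cnj (coord u i) * coord u i))"
    unfolding inner_ell2_def by (intro infsum_Re[symmetric] square_summable_cinner) auto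
  also have "\<dots> = (\<Sum>\<^sub>\<infinity>i. (cmod (coord u i))\<^sup>2)"
    by (intro infsum_cong) (simp only: cmod_power2, simp add: power2_eq_square)
  finally show ?thesis .
qed

instance
proof
  fix u v w :: "'a ell2" and r :: real
  show "dist u v = norm (u - v)" by (simp add: dist_ell2_def norm_ell2_def)
  show "sgn u = u /\<^sub>R norm u" by (simp add: sgn_ell2_def norm_ell2_def)
  show "uniformity = (INF e\<in>{0<..}. principal {(u :: 'a ell2, v). dist u v < e})"
    by (simp add: uniformity_ell2_def dist_ell2_def)
  show "open U \<longleftrightarrow> (\<forall>u\<in>U. eventually (\<lambda>(u', v). u' = u \<longrightarrow> v \<in> U) uniformity)"
    for U :: "'a ell2 set"
    by (simp add: open_ell2_def uniformity_ell2_def)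
  show "norm u = sqrt (inner u u)" by (simp add: norm_ell2_def l2_norm_def inner_ell2_self)
  have "(\<Sum>\<^sub>\<infinity>i. cnj (coord u i) * coord v i) = cnj (\<Sum>\<^sub>\<infinity>i. cnj (coord v i) * coord u i)"
    unfolding infsum_cnj[symmetric] by (simp add: mult.commute)
  then show "inner u v = inner v u"
    unfolding inner_ell2_def by simp
  have "(\<Sum>\<^sub>\<infinity>i. cnj (coord (u + v) i) * coord w i) =
        (\<Sum>\<^sub>\<infinity>i. cnj (coord u i) * coord w i + cnj (coord v i) * coord w i)"
    by (simp add: algebra_simps)
  also have "\<dots> = (\<Sum>\<^sub>\<infinity>i. cnj (coord u i) * coord w i) + (\<Sum>\<^sub>\<infinity>i. cnj (coord v i) * coord w i)"
    by (intro infsum_add square_summable_cinner) auto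
  finally show "inner (u + v) w = inner u w + inner v w"
    unfolding inner_ell2_def by simp
  have "(\<Sum>\<^sub>\<infinity>i. cnj (coord (scaleR r u) i) * coord v i) =
        (\<Sum>\<^sub>\<infinity>i. complex_of_real r * (cnj (coord u i) * coord v i))"
    by (simp add: mult.assoc)
  also have "\<dots> = complex_of_real r * (\<Sum>\<^sub>\<infinity>i. cnj (coord u i) * coord v i)"
    by (rule infsum_cmult_right')
  finally show "inner (scaleR r u) v = r * inner u v"
    unfolding inner_ell2_def by simp
  show "0 \<le> inner u u"
    unfolding inner_ell2_self by (intro infsum_nonneg) auto
  show "inner u u = 0 \<longleftrightarrow> u = 0"
  proof
    assume "inner u u = 0"
    then have z: "(\<Sum>\<^sub>\<infinity>i. (cmod (coord u i))\<^sup>2) \<le> 0" by (simp add: inner_ell2_self)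
    have "(cmod (coord u i))\<^sup>2 = 0" for i
      by (rule nonneg_infsum_le_0D[OF z])
        (use square_summable_coord[of u] in \<open>auto simp: square_summable_def\<close>)
    then show "u = 0" by (intro ell2_eqI) simp
  qed (simp add: inner_ell2_self)
qed

end

lemma norm_ell2_eq: "norm u = sqrt (\<Sum>\<^sub>\<infinity>i. (cmod (coord u i))\<^sup>2)"
  by (simp add: norm_ell2_def l2_norm_def)

lemma sum_coord_le_norm:
  assumes "finite F"
  shows "(\<Sum>i\<in>F. (cmod (coord u i))\<^sup>2) \<le> (norm u)\<^sup>2"
proof -
  have "(norm u)\<^sup>2 = (\<Sum>\<^sub>\<infinity>i. (cmod (coord u i))\<^sup>2)"
    by (simp add: norm_ell2_eq infsum_nonneg)
  then show ?thesis
    using finite_sum_le_infsum[of "\<lambda>i. (cmod (coord u i))\<^sup>2" UNIV F] assms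
      square_summable_coord[of u] by (simp add: square_summable_def)
qed

lemma cmod_coord_le_norm: "cmod (coord u i) \<le> norm u"
  using sum_coord_le_norm[of "{i}" u] by (simp add: power2_le_iff_abs_le)

instantiation ell2 :: (type) complex_hilbert
begin

definition scaleC_ell2 :: "complex \<Rightarrow> 'a ell2 \<Rightarrow> 'a ell2" where
  "scaleC z u = Abs_ell2 (\<lambda>i. z * coord u i)"
definition cinner_ell2 :: "'a ell2 \<Rightarrow> 'a ell2 \<Rightarrow> complex" where
  "cinner u v = (\<Sum>\<^sub>\<infinity>i. cnj (coord u i) * coord v i)"

lemma coord_scaleC [simp]: "coord (scaleC z u) i = z * coord u i" for u :: "'a ell2"
  by (simp add: scaleC_ell2_def coord_Abs_ell2 square_summable_cmult)

instance
proof
  fix X :: "nat \<Rightarrow> 'a ell2"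
  assume C: "Cauchy X"
  have "Cauchy (\<lambda>n. coord (X n) i)" for i
  proof (rule metric_CauchyI)
    fix e :: real
    assume "0 < e"
    then obtain N where N: "\<And>m n. m \<ge> N \<Longrightarrow> n \<ge> N \<Longrightarrow> dist (X m) (X n) < e"
      using C unfolding Cauchy_def by blast
    have "dist (coord (X m) i) (coord (X n) i) < e" if "m \<ge> N" "n \<ge> N" for m n
      using N[OF that] cmod_coord_le_norm[of "X m - X n" i] by (simp add: dist_norm)
    then show "\<exists>M. \<forall>m\<ge>M. \<forall>n\<ge>M. dist (coord (X m) i) (coord (X n) i) < e" by blast
  qed
  then have "\<exists>l. (\<lambda>n. coord (X n) i) \<longlonglongrightarrow> l" for i
    by (simp add: Cauchy_convergent_iff convergent_def)
  then obtain L where L: "\<And>i. (\<lambda>n. coord (X n) i) \<longlonglongrightarrow> L i" by metis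
  have tail: "\<exists>N. \<forall>m\<ge>N. \<forall>F. finite F \<longrightarrow> (\<Sum>i\<in>F. (cmod (coord (X m) i - L i))\<^sup>2) \<le> e\<^sup>2"
    if e: "0 < e" for e
  proof -
    obtain N where N: "\<And>m n. m \<ge> N \<Longrightarrow> n \<ge> N \<Longrightarrow> dist (X m) (X n) < e"
      using C e unfolding Cauchy_def by blast
    have "(\<Sum>i\<in>F. (cmod (coord (X m) i - L i))\<^sup>2) \<le> e\<^sup>2" if "m \<ge> N" "finite F" for m F
    proof (rule LIMSEQ_le_const2)
      show "(\<lambda>n. \<Sum>i\<in>F. (cmod (coord (X m) i - coord (X n) i))\<^sup>2)
            \<longlonglongrightarrow> (\<Sum>i\<in>F. (cmod (coord (X m) i - L i))\<^sup>2)"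
        by (intro tendsto_intros L)
      have "(\<Sum>i\<in>F. (cmod (coord (X m) i - coord (X n) i))\<^sup>2) \<le> e\<^sup>2" if "n \<ge> N" for n
      proof -
        have "(\<Sum>i\<in>F. (cmod (coord (X m) i - coord (X n) i))\<^sup>2) \<le> (norm (X m - X n))\<^sup>2"
          using sum_coord_le_norm[OF \<open>finite F\<close>, of "X m - X n"] by simp
        also have "\<dots> \<le> e\<^sup>2"
          using N[OF \<open>m \<ge> N\<close> that] by (intro power_mono) (auto simp: dist_norm)
        finally show ?thesis .
      qed
      then show "\<exists>N. \<forall>n\<ge>N. (\<Sum>i\<in>F. (cmod (coord (X m) i - coord (X n) i))\<^sup>2) \<le> e\<^sup>2" by blast
    qed
    then show ?thesis by blast
  qed
  have diff: "square_summable (\<lambda>i. coord (X m) i - L i)"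
    if "\<forall>F. finite F \<longrightarrow> (\<Sum>i\<in>F. (cmod (coord (X m) i - L i))\<^sup>2) \<le> e\<^sup>2" for m e
    unfolding square_summable_def
    by (rule nonneg_bdd_above_summable_on) (use that in \<open>auto intro!: bdd_aboveI\<close>)
  obtain N where "\<forall>F. finite F \<longrightarrow> (\<Sum>i\<in>F. (cmod (coord (X N) i - L i))\<^sup>2) \<le> 1\<^sup>2"
    using tail[of 1] by auto
  then have "square_summable (\<lambda>i. coord (X N) i - (coord (X N) i - L i))"
    by (intro square_summable_diff square_summable_coord diff[of _ 1])
  then have cL: "coord (Abs_ell2 L) = L"
    by (simp add: coord_Abs_ell2)
  have "X \<longlonglongrightarrow> Abs_ell2 L"
  proof (rule metric_LIMSEQ_I)
    fix e :: real
    assume e: "0 < e"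
    then obtain N where N: "\<forall>m\<ge>N. \<forall>F. finite F \<longrightarrow>
        (\<Sum>i\<in>F. (cmod (coord (X m) i - L i))\<^sup>2) \<le> (e / 2)\<^sup>2"
      using tail[of "e / 2"] by auto
    have "dist (X m) (Abs_ell2 L) < e" if "m \<ge> N" for m
    proof -
      have "(\<Sum>\<^sub>\<infinity>i. (cmod (coord (X m) i - L i))\<^sup>2) \<le> (e / 2)\<^sup>2"
        using diff[of m "e / 2"] N that unfolding square_summable_def
        by (intro infsum_le_finite_sums) auto
      then have "dist (X m) (Abs_ell2 L) \<le> e / 2"
        using e real_le_lsqrt[of "e / 2"] by (simp only: dist_norm norm_ell2_eq cL coord_vector_ops)
      then show ?thesis using e by simp
    qed
    then show "\<exists>N. \<forall>m\<ge>N. dist (X m) (Abs_ell2 L) < e" by blast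
  qed
  then show "convergent X" by (rule convergentI)
next
  fix u v w :: "'a ell2" and y z :: complex and r :: real
  show "scaleC z (u + v) = scaleC z u + scaleC z v"
    and "scaleC (y + z) u = scaleC y u + scaleC z u"
    and "scaleC y (scaleC z u) = scaleC (y * z) u"
    and "scaleC (complex_of_real r) u = scaleR r u"
    by (auto intro!: ell2_eqI simp: algebra_simps)
  show "cinner u v = cnj (cinner v u)"
    unfolding cinner_ell2_def infsum_cnj[symmetric] by (simp add: mult.commute)
  have "cinner u (v + w) = (\<Sum>\<^sub>\<infinity>i. cnj (coord u i) * coord v i + cnj (coord u i) * coord w i)"
    unfolding cinner_ell2_def by (simp add: algebra_simps)
  also have "\<dots> = cinner u v + cinner u w"
    unfolding cinner_ell2_def by (intro infsum_add square_summable_cinner) auto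
  finally show "cinner u (v + w) = cinner u v + cinner u w" .
  have "cinner u (scaleC z v) = (\<Sum>\<^sub>\<infinity>i. z * (cnj (coord u i) * coord v i))"
    unfolding cinner_ell2_def by (simp add: mult.left_commute)
  also have "\<dots> = z * cinner u v"
    unfolding cinner_ell2_def by (rule infsum_cmult_right')
  finally show "cinner u (scaleC z v) = z * cinner u v" .
  show "Re (cinner u v) = inner u v"
    by (simp add: cinner_ell2_def inner_ell2_def)
qed

end

section \<open>Periodic Jacobi operators\<close>

definition periodic_seq :: "nat \<Rightarrow> (int \<Rightarrow> real) \<Rightarrow> bool" where
  "periodic_seq p s \<longleftrightarrow> (\<forall>i. s (i + int p) = s i)"

text \<open>
  \<^const>\<open>Abs_ell2\<close> is unspecified off the square-summable families; for bounded, hence for periodic,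
  coefficients the lemmas \<open>coord_jacobi\<close> and \<open>bounded_clinear_jacobi\<close> below show that the
  operator is the intended one.
\<close>

definition jacobi ::
  "(int \<Rightarrow> real) \<Rightarrow> (int \<Rightarrow> real) \<Rightarrow> (int \<Rightarrow> real) \<Rightarrow> int ell2 \<Rightarrow> int ell2" where
  "jacobi a b c u = Abs_ell2 (\<lambda>n. of_real (c (n - 1)) * coord u (n - 1)
      + of_real (a n) * coord u n + of_real (b n) * coord u (n + 1))"

text \<open>The set is finite, so that \<^const>\<open>Max\<close> is meaningful, when \<open>a\<close> is periodic with \<open>p > 0\<close>.\<close>

definition omega0 :: "(int \<Rightarrow> real) \<Rightarrow> real" where
  "omega0 a = Max {\<bar>a i - a 0\<bar> | i. 0 \<le> i}"

lemma periodic_seq_mod: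
  assumes "periodic_seq p s"
  shows "s (i mod int p) = s i"
proof -
  have *: "s (j + int k * int p) = s j" for j k
  proof (induction k)
    case (Suc k)
    have "s (j + int (Suc k) * int p) = s ((j + int k * int p) + int p)"
      by (simp add: algebra_simps)
    then show ?case using assms Suc by (simp add: periodic_seq_def)
  qed simp
  show ?thesis
  proof (cases "i div int p \<ge> 0")
    case True
    then show ?thesis
      using *[of "i mod int p" "nat (i div int p)"] by simp
  next
    case False
    then have "i + int (nat (- (i div int p))) * int p = i mod int p"
      by (simp add: minus_mult_div_eq_mod[symmetric] algebra_simps)
    then show ?thesis
      using *[of i "nat (- (i div int p))"] by simp
  qed
qed

lemma periodic_seq_range:
  assumes "periodic_seq p s" "p > 0"
  shows "s i \<in> s ` {0..<int p}"
  using periodic_seq_mod[OF assms(1), of i] assms(2)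
  by (metis atLeastLessThan_iff image_eqI of_nat_0_less_iff pos_mod_bound pos_mod_sign)

lemma periodic_seq_bounded:
  assumes "periodic_seq p s" "p > 0"
  obtains B where "\<And>i. \<bar>s i\<bar> \<le> B"
proof
  show "\<bar>s i\<bar> \<le> Max ((\<lambda>i. \<bar>s i\<bar>) ` {0..<int p})" for i
    using periodic_seq_range[OF assms, of i] by (intro Max_ge) auto
qed

lemma finite_omega0_set:
  assumes "periodic_seq p a" "p > 0"
  shows "finite {\<bar>a i - a 0\<bar> | i. 0 \<le> i}"
proof (rule finite_subset)
  show "{\<bar>a i - a 0\<bar> | i. 0 \<le> i} \<subseteq> (\<lambda>x. \<bar>x - a 0\<bar>) ` a ` {0..<int p}"
    using periodic_seq_range[OF assms] by blast
qed simp

lemma bij_plus_int: "bij (\<lambda>n::int. n + k)"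
  by (rule o_bij[of "\<lambda>n. n - k"]) (auto simp: fun_eq_iff)

lemma square_summable_jacobi:
  assumes "periodic_seq p a" "periodic_seq p b" "periodic_seq p c" "p > 0"
    and f: "square_summable f"
  shows "square_summable (\<lambda>n. of_real (c (n - 1)) * f (n - 1)
      + of_real (a n) * f n + of_real (b n) * f (n + 1))"
proof -
  have piece: "square_summable (\<lambda>n. of_real (s (n + j)) * f (n + k))"
    if s: "periodic_seq p s" for s j k
  proof -
    obtain B where B: "\<And>i. \<bar>s i\<bar> \<le> B"
      using periodic_seq_bounded[OF s \<open>p > 0\<close>] by blast
    show ?thesis
      by (rule square_summable_bounded_mult[OF square_summable_reindex[OF f bij_plus_int], of _ B])
        (simp add: B)
  qed
  have "square_summable (\<lambda>n. of_real (c (n + (- 1))) * f (n + (- 1))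
      + of_real (a (n + 0)) * f (n + 0) + of_real (b (n + 0)) * f (n + 1))"
    by (rule square_summable_add[OF square_summable_add]) (rule piece assms)+
  then show ?thesis by simp
qed

lemma coord_jacobi:
  assumes "periodic_seq p a" "periodic_seq p b" "periodic_seq p c" "p > 0"
  shows "coord (jacobi a b c u) n = of_real (c (n - 1)) * coord u (n - 1)
      + of_real (a n) * coord u n + of_real (b n) * coord u (n + 1)"
  unfolding jacobi_def by (subst coord_Abs_ell2) (auto intro: square_summable_jacobi[OF assms])

lemma norm_Abs_ell2_bounded_mult:
  assumes "square_summable f" "\<And>i. cmod (d i) \<le> B"
  shows "norm (Abs_ell2 (\<lambda>i. d i * f i)) \<le> B * norm (Abs_ell2 f)"
proof -
  have B: "0 \<le> B" using assms(2) norm_ge_zero order_trans by blast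
  have s: "square_summable (\<lambda>i. d i * f i)" by (rule square_summable_bounded_mult[OF assms])
  have "(\<Sum>\<^sub>\<infinity>i. (cmod (d i * f i))\<^sup>2) \<le> (\<Sum>\<^sub>\<infinity>i. B\<^sup>2 * (cmod (f i))\<^sup>2)"
  proof (rule infsum_mono)
    show "(\<lambda>i. (cmod (d i * f i))\<^sup>2) summable_on UNIV"
      using s by (simp add: square_summable_def)
    show "(\<lambda>i. B\<^sup>2 * (cmod (f i))\<^sup>2) summable_on UNIV"
      using assms(1) unfolding square_summable_def by (intro summable_on_cmult_right)
    show "(cmod (d i * f i))\<^sup>2 \<le> B\<^sup>2 * (cmod (f i))\<^sup>2" for i
      unfolding norm_mult power_mult_distrib
      by (intro mult_right_mono power_mono assms(2)) auto
  qed
  also have "\<dots> = B\<^sup>2 * (\<Sum>\<^sub>\<infinity>i. (cmod (f i))\<^sup>2)" by (rule infsum_cmult_right')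
  finally have "sqrt (\<Sum>\<^sub>\<infinity>i. (cmod (d i * f i))\<^sup>2) \<le> sqrt (B\<^sup>2 * (\<Sum>\<^sub>\<infinity>i. (cmod (f i))\<^sup>2))"
    by (rule real_sqrt_le_mono)
  then show ?thesis
    using B by (simp add: norm_ell2_eq coord_Abs_ell2 s assms(1) real_sqrt_mult)
qed

lemma norm_Abs_ell2_reindex:
  assumes "square_summable f" "bij h"
  shows "norm (Abs_ell2 (\<lambda>i. f (h i))) = norm (Abs_ell2 f)"
  using infsum_reindex_bij_betw[of h UNIV UNIV "\<lambda>i. (cmod (f i))\<^sup>2"] assms
  by (simp add: norm_ell2_eq coord_Abs_ell2 square_summable_reindex)

lemma bounded_clinear_jacobi:
  assumes "periodic_seq p a" "periodic_seq p b" "periodic_seq p c" "p > 0"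
  shows "bounded_clinear (jacobi a b c)"
proof -
  note J = coord_jacobi[OF assms]
  obtain A where A: "\<And>i. \<bar>a i\<bar> \<le> A"
    using periodic_seq_bounded[of p a] assms by blast
  obtain B where B: "\<And>i. \<bar>b i\<bar> \<le> B"
    using periodic_seq_bounded[of p b] assms by blast
  obtain C where C: "\<And>i. \<bar>c i\<bar> \<le> C"
    using periodic_seq_bounded[of p c] assms by blast
  have piece: "square_summable (\<lambda>n. of_real (d n) * coord u (n + k))"
    "norm (Abs_ell2 (\<lambda>n. of_real (d n) * coord u (n + k))) \<le> D * norm u"
    if "\<And>i. \<bar>d i\<bar> \<le> D" for d :: "int \<Rightarrow> real" and D u k
  proof -
    have s: "square_summable (\<lambda>n. coord u (n + k))"
      by (rule square_summable_reindex[OF square_summable_coord bij_plus_int])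
    show "square_summable (\<lambda>n. of_real (d n) * coord u (n + k))"
      by (rule square_summable_bounded_mult[OF s, of _ D]) (simp add: that)
    show "norm (Abs_ell2 (\<lambda>n. of_real (d n) * coord u (n + k))) \<le> D * norm u"
      using norm_Abs_ell2_bounded_mult[OF s, of "\<lambda>n. of_real (d n)" D] that
        norm_Abs_ell2_reindex[OF square_summable_coord bij_plus_int, of u k]
      by (simp add: coord_inverse)
  qed
  have "bounded_linear (jacobi a b c)"
  proof (rule bounded_linear_intro)
    show "jacobi a b c (u + v) = jacobi a b c u + jacobi a b c v" for u v
      by (rule ell2_eqI) (simp add: J algebra_simps)
    show "jacobi a b c (scaleR r u) = scaleR r (jacobi a b c u)" for r u
      by (rule ell2_eqI) (simp add: J algebra_simps)
    show "norm (jacobi a b c u) \<le> norm u * (C + A + B)" for u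
    proof -
      let ?C = "Abs_ell2 (\<lambda>n. of_real (c (n - 1)) * coord u (n + (- 1)))"
      let ?A = "Abs_ell2 (\<lambda>n. of_real (a n) * coord u (n + 0))"
      let ?B = "Abs_ell2 (\<lambda>n. of_real (b n) * coord u (n + 1))"
      have "jacobi a b c u = ?C + ?A + ?B"
        by (rule ell2_eqI) (simp only: J coord_vector_ops coord_Abs_ell2[OF piece(1)[OF C]]
            coord_Abs_ell2[OF piece(1)[OF A]] coord_Abs_ell2[OF piece(1)[OF B]], simp)
      then have "norm (jacobi a b c u) \<le> norm ?C + norm ?A + norm ?B"
        using norm_triangle_ineq[of "?C + ?A" ?B] norm_triangle_ineq[of ?C ?A] by simp
      also have "\<dots> \<le> C * norm u + A * norm u + B * norm u"
        by (intro add_mono piece(2) A B C)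
      finally show ?thesis by (simp add: algebra_simps)
    qed
  qed
  moreover have "jacobi a b c (scaleC z u) = scaleC z (jacobi a b c u)" for z u
    by (rule ell2_eqI) (simp add: J algebra_simps)
  ultimately show ?thesis by (simp add: bounded_clinear_def)
qed

end

theory Submission
  imports Defs "HOL-Complex_Analysis.Complex_Analysis"
begin

text \<open>
  Let \<open>T\<close> be the Laurent operator with the diagonal entry \<open>a 0\<close> and \<open>E\<close> its symbol curve (an ellipse).
  Since \<open>T\<close> is normal and \<open>\<parallel>J - T\<parallel> \<le> \<omega>\<close>, the resolvent of \<open>J\<close> at \<open>z\<close> exists and has norm at most
  \<open>1 / (dist z E - \<omega>)\<close> as soon as \<open>dist z E > \<omega>\<close>, while approximate eigenvectors of \<open>T\<close> show that
  the open \<open>2\<omega>\<close>-neighbourhood \<open>U\<close> of \<open>E\<close> lies in the \<open>3\<omega>\<close>-pseudospectrum.  So \<open>U\<close> is a path-connected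
  neighbourhood of the spectrum, and each other point \<open>z0\<close> of the pseudospectrum has to be joined to it.
  By Montel's theorem there is a holomorphic \<open>f\<close> with \<open>\<bar>f z\<bar> \<le> \<parallel>(z I - J)\<^sup>-\<^sup>1\<parallel>\<close> everywhere and
  \<open>\<bar>f z0\<bar> \<ge> 1 / (3\<omega>)\<close>: a limit of matrix coefficients of the resolvent, as the norm need not be attained.
  Unless \<open>f\<close> is locally constant at \<open>z0\<close>, a short segment leads from \<open>z0\<close> into \<open>{\<bar>f\<bar> > \<bar>f z0\<bar>}\<close>, and by the maximum principle, as \<open>f\<close> vanishes
  at infinity, the component of this open set reached there meets \<open>U\<close>.  If \<open>f\<close> is locally constant, it is
  constant on the whole component of \<open>z0\<close> in its domain, which then meets \<open>U\<close> for the same reason.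
\<close>

section \<open>Complex Hilbert spaces and resolvents\<close>

lemma cinner_diff_right: "cinner x (u - v) = cinner x u - cinner x v" for x :: "'a::complex_hilbert"
  using cinner_add_right[of x "u - v" v] by (simp add: algebra_simps)

lemma scaleC_diff_right: "scaleC w (x - y) = scaleC w x - scaleC w y" for x :: "'a::complex_hilbert"
  using scaleC_add_right[of w "x - y" y] by (simp add: algebra_simps)

lemma scaleC_diff_left: "scaleC (z - w) x = scaleC z x - scaleC w x" for x :: "'a::complex_hilbert"
  using scaleC_add_left[of "z - w" w x] by (simp add: algebra_simps)

lemma norm_scaleC: "norm (scaleC z x) = cmod z * norm x" for x :: "'a::complex_hilbert"
proof -
  have "cinner (scaleC z x) (scaleC z x) = z * (cnj z * cnj (cinner x x))"
    by (metis cinner_commute cinner_scaleC_right complex_cnj_mult)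
  then have "cinner (scaleC z x) (scaleC z x) = of_real ((cmod z)\<^sup>2) * cnj (cinner x x)"
    by (simp only: complex_norm_square mult.assoc)
  then have "Re (cinner (scaleC z x) (scaleC z x)) = (cmod z)\<^sup>2 * Re (cinner x x)"
    by (simp only: times_complex.simps Re_complex_of_real Im_complex_of_real cnj.simps mult_zero_left diff_zero)
  then have "(norm (scaleC z x))\<^sup>2 = (cmod z * norm x)\<^sup>2"
    by (simp only: Re_cinner power2_norm_eq_inner power_mult_distrib)
  then show ?thesis by (rule power2_eq_imp_eq) auto
qed

text \<open>Rotating \<open>y\<close> by a unimodular scalar makes the inner product real and
  nonnegative, which reduces the claim to the real Cauchy-Schwarz inequality.\<close>

lemma cmod_cinner_le: "cmod (cinner x y) \<le> norm x * norm y" for x :: "'a::complex_hilbert"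
proof (cases "cinner x y = 0")
  case False
  define w where "w = cnj (sgn (cinner x y))"
  have w: "cmod w = 1" using False by (simp add: w_def norm_sgn)
  have "cinner x (scaleC w y) = of_real (cmod (cinner x y))"
    unfolding w_def cinner_scaleC_right sgn_eq using False
    by (simp add: mult.commute[of "cnj _"] complex_norm_square[symmetric] power2_eq_square)
  then have "cmod (cinner x y) = inner x (scaleC w y)" by (metis Re_cinner Re_complex_of_real)
  also have "\<dots> \<le> norm x * norm (scaleC w y)" by (rule norm_cauchy_schwarz)
  finally show ?thesis using w by (simp add: norm_scaleC)
qed simp

section \<open>Invertibility, resolvent bounds and approximate eigenvectors\<close>

text \<open>The lower bound for \<open>N\<close> gives injectivity; the one for the adjoint
  \<open>N'\<close> makes \<open>N \<circ> N'\<close> coercive and so gives surjectivity.\<close>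

lemma bij_of_bounded_below_adjoint:
  fixes N N' :: "'a::{real_inner,complete_space} \<Rightarrow> 'a"
  assumes "bounded_linear N" "bounded_linear N'"
    and adj: "\<And>u v. inner (N u) v = inner u (N' v)"
    and d: "0 < d" "\<And>u. d * norm u \<le> norm (N u)" "\<And>u. d * norm u \<le> norm (N' u)"
  shows "bij N"
proof (rule bijI)
  interpret N: bounded_linear N by fact
  interpret N': bounded_linear N' by fact
  show "inj N"
  proof (rule injI)
    fix u v assume "N u = N v"
    then have "d * norm (u - v) \<le> 0" using d(2)[of "u - v"] by (simp add: N.diff)
    then show "u = v" using d(1) by (simp add: mult_le_0_iff)
  qed
  obtain B where B: "\<And>u. norm (N u) \<le> norm u * B" "B > 0" using N.pos_bounded by blast
  show "surj N"
  \<comment> \<open>\<open>N \<circ> N'\<close> is positive definite, so Richardson iteration solves \<open>N (N' x) = y\<close>.\<close>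
  proof (rule surjI)
    fix y
    \<comment> \<open>The step size must satisfy \<open>t * B\<^sup>2 \<le> 1\<close>, so that the
      quadratic term is absorbed by half of the linear one, and
      \<open>t * d\<^sup>2 \<le> 1\<close>, so that the square root in \<open>q\<close> is that of a
      nonnegative number.\<close>
    define t where "t = 1 / (d\<^sup>2 + B\<^sup>2)"
    have den: "d\<^sup>2 + B\<^sup>2 > 0" using d(1) by (simp add: add_pos_nonneg)
    have t: "t > 0" "t * B\<^sup>2 \<le> 1" "0 < t * d\<^sup>2" "t * d\<^sup>2 \<le> 1"
      using den d(1) by (auto simp: t_def field_simps)
    define q where "q = sqrt (1 - t * d\<^sup>2)"
    define F where "F x = x - t *\<^sub>R (N (N' x) - y)" for x
    have q: "0 \<le> q" "q < 1" using t by (auto simp: q_def)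
    have "dist (F x) (F x') \<le> q * dist x x'" for x x'
    proof -
      define e where "e = x - x'"
      have F: "F x - F x' = e - t *\<^sub>R N (N' e)" by (simp add: F_def e_def N.diff N'.diff algebra_simps)
      have "(norm (e - t *\<^sub>R N (N' e)))\<^sup>2 = (norm e)\<^sup>2 - 2 * t * inner e (N (N' e)) + t\<^sup>2 * (norm (N (N' e)))\<^sup>2"
        unfolding power2_norm_eq_inner inner_diff_left inner_diff_right
        by (simp only: inner_commute[of "N (N' e)" e] inner_scaleR_left inner_scaleR_right power2_eq_square algebra_simps)
      also have "inner e (N (N' e)) = (norm (N' e))\<^sup>2"
        by (metis adj inner_commute power2_norm_eq_inner)
      also have "t\<^sup>2 * (norm (N (N' e)))\<^sup>2 \<le> t\<^sup>2 * (norm (N' e) * B)\<^sup>2"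
        by (intro mult_left_mono power_mono B) auto
      also have "t\<^sup>2 * (norm (N' e) * B)\<^sup>2 = t * (t * B\<^sup>2) * (norm (N' e))\<^sup>2"
        by (simp add: power2_eq_square)
      also have "\<dots> \<le> t * (norm (N' e))\<^sup>2"
        using t by (intro mult_right_mono) auto
      finally have "(norm (e - t *\<^sub>R N (N' e)))\<^sup>2 \<le> (norm e)\<^sup>2 - t * (norm (N' e))\<^sup>2"
        by simp
      also have "\<dots> \<le> (norm e)\<^sup>2 - t * (d * norm e)\<^sup>2"
        using t d by (intro diff_left_mono mult_left_mono power_mono) auto
      also have "\<dots> = (q * norm e)\<^sup>2" using t by (simp add: q_def power_mult_distrib algebra_simps)
      finally have "norm (e - t *\<^sub>R N (N' e)) \<le> q * norm e"
        by (rule power2_le_imp_le) (use q in simp)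
      then show ?thesis by (simp add: dist_norm F e_def)
    qed
    then obtain x where "F x = x" using banach_fix_type[OF q, of F] by blast
    then have "N (N' x) = y" using t(1) by (simp add: F_def)
    then show "N (N' (SOME x. N (N' x) = y)) = y" by (rule someI)
  qed
qed

text \<open>The inverse of a bijective linear map is linear, and the lower bound evaluated at
  \<open>?R y\<close> is the norm bound for the inverse.\<close>

lemma resolvent_bounded_below:
  assumes A: "bounded_clinear A" and bij: "bij (\<lambda>x. scaleC z x - A x)"
    and d: "0 < d" "\<And>x. d * norm x \<le> norm (scaleC z x - A x)"
  shows "z \<notin> op_spectrum A" "onorm (resolvent_op A z) \<le> 1 / d"
proof -
  let ?N = "\<lambda>x. scaleC z x - A x" and ?R = "resolvent_op A z"
  have NR: "?N (?R y) = y" for y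
    unfolding resolvent_op_def by (rule surj_f_inv_f[OF bij_is_surj[OF bij]])
  have RI: "?R y = x" if "?N x = y" for x y
    unfolding resolvent_op_def that[symmetric] by (rule inv_f_f[OF bij_is_inj[OF bij]])
  have A': "A (x + y) = A x + A y" "A (scaleC w x) = scaleC w (A x)" for x y w
    using A by (auto simp: bounded_clinear_def bounded_linear_def linear_add)
  have R: "norm (?R y) \<le> norm y / d" for y
    using d(2)[of "?R y"] d(1) NR[of y] by (simp add: field_simps)
  have add: "?R (x + y) = ?R x + ?R y" for x y
    by (rule RI) (use NR[of x] NR[of y] in \<open>simp add: A' scaleC_add_right algebra_simps\<close>)
  have scale: "?R (scaleC w x) = scaleC w (?R x)" for w x
  proof (rule RI)
    have "?N (scaleC w (?R x)) = scaleC w (?N (?R x))"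
      by (simp add: A' scaleC_diff_right scaleC_scaleC mult.commute)
    then show "?N (scaleC w (?R x)) = scaleC w x" using NR by simp
  qed
  have "bounded_linear ?R"
    by (rule bounded_linear_intro[of _ "1 / d"])
      (use add scale[of "of_real _"] R in \<open>auto simp: scaleC_of_real\<close>)
  then show "z \<notin> op_spectrum A" using bij scale by (simp add: op_spectrum_def bounded_clinear_def)
  show "onorm ?R \<le> 1 / d" by (rule onorm_bound) (use R d in auto)
qed

text \<open>A vector with ratio \<eta> forces the resolvent norm to be at least 1/\<eta>. Asking for
  every \<eta> > \<epsilon> and passing to the limit spares a vector that attains \<epsilon>
  itself.\<close>

lemma pseudospectrum_approx_eigenvector:
  assumes "0 \<le> \<epsilon>" and A: "bounded_clinear A"
    and ap: "\<And>\<eta>. \<eta> > \<epsilon> \<Longrightarrow> \<exists>x. x \<noteq> 0 \<and> norm (scaleC z x - A x) \<le> \<eta> * norm x"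
  shows "z \<in> pseudospectrum \<epsilon> A"
proof (cases "z \<in> op_spectrum A")
  case True
  then show ?thesis by (simp add: pseudospectrum_def)
next
  case False
  let ?R = "resolvent_op A z"
  have bij: "bij (\<lambda>x. scaleC z x - A x)" and R: "bounded_linear ?R"
    using False by (auto simp: op_spectrum_def bounded_clinear_def)
  have *: "1 \<le> onorm ?R * \<eta>" if \<eta>: "\<eta> > \<epsilon>" for \<eta>
  proof -
    obtain x where x: "x \<noteq> 0" "norm (scaleC z x - A x) \<le> \<eta> * norm x" using ap[OF \<eta>] by blast
    have "norm x = norm (?R (scaleC z x - A x))"
      unfolding resolvent_op_def using inv_f_f[OF bij_is_inj[OF bij], of x] by simp
    also have "\<dots> \<le> onorm ?R * norm (scaleC z x - A x)" by (rule onorm[OF R])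
    also have "\<dots> \<le> onorm ?R * (\<eta> * norm x)" by (intro mult_left_mono x onorm_pos_le[OF R])
    finally show ?thesis using x(1) by (simp flip: mult.assoc)
  qed
  have "1 \<le> onorm ?R * \<epsilon>"
  proof (rule tendsto_lowerbound)
    show "((\<lambda>\<eta>. onorm ?R * \<eta>) \<longlongrightarrow> onorm ?R * \<epsilon>) (at_right \<epsilon>)" by (intro tendsto_intros)
    show "\<forall>\<^sub>F \<eta> in at_right \<epsilon>. 1 \<le> onorm ?R * \<eta>"
      by (rule eventually_mono[OF eventually_at_right_less]) (use * in auto)
  qed simp
  \<comment> \<open>With \<epsilon> = 0 the inequality would read 1 \<le> 0, so off the spectrum
    only the first branch of \<open>pseudospectrum\<close> can occur.\<close>
  then have "\<epsilon> > 0" using assms(1) by (cases "\<epsilon> = 0") auto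
  then show ?thesis using False \<open>1 \<le> onorm ?R * \<epsilon>\<close> by (simp add: pseudospectrum_def field_simps)
qed

text \<open>Otherwise \<open>z I - A\<close> would be bounded below by \<eta> on unit vectors, hence
  everywhere by homogeneity, and the resolvent norm would be at most 1/\<eta> < 1/\<epsilon>. The
  slack \<eta> > \<epsilon> is there because the norm may not be attained.\<close>

lemma approx_eigenvector_of_onorm_resolvent:
  assumes A: "bounded_clinear A" and z: "z \<notin> op_spectrum A" "onorm (resolvent_op A z) \<ge> 1 / \<epsilon>" 
    and \<eta>: "0 < \<epsilon>" "\<epsilon> < \<eta>"
  obtains x where "norm x = 1" "norm (scaleC z x - A x) < \<eta>"
proof (rule ccontr)
  let ?N = "\<lambda>x. scaleC z x - A x"
  assume "\<not> thesis"
  then have below: "\<eta> \<le> norm (?N x)" if "norm x = 1" for x using that \<open>\<And>x. _ \<Longrightarrow> _ \<Longrightarrow> thesis\<close> by force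
  have lin: "?N (r *\<^sub>R x) = r *\<^sub>R ?N x" for r x
  proof -
    have "A (r *\<^sub>R x) = r *\<^sub>R A x" using A by (simp add: bounded_clinear_def bounded_linear_def linear_scale)
    moreover have "scaleC z (r *\<^sub>R x) = r *\<^sub>R scaleC z x"
      by (metis mult.commute scaleC_of_real scaleC_scaleC)
    ultimately show ?thesis by (simp add: scaleR_right_diff_distrib)
  qed
  have "\<eta> * norm x \<le> norm (?N x)" for x
  proof (cases "x = 0")
    case False
    then have "\<eta> \<le> norm (?N (inverse (norm x) *\<^sub>R x))" by (intro below) simp
    then show ?thesis using False by (simp only: lin norm_scaleR) (simp add: field_simps)
  qed (use lin[of 0 0] in simp)
  then have "onorm (resolvent_op A z) \<le> 1 / \<eta>"
    using z \<eta> by (intro resolvent_bounded_below(2)[OF A]) (auto simp: op_spectrum_def)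
  also have "\<dots> < 1 / \<epsilon>" using \<eta> by (intro divide_strict_left_mono) auto
  finally show False using z by simp
qed

section \<open>Analytic dependence of the resolvent on the spectral parameter\<close>

text \<open>The first resolvent identity: for \<open>v = R w y\<close> one has
  \<open>(z I - A) v = y - (w - z) v\<close>, and applying \<open>R z\<close> gives the
  claim.\<close>

lemma resolvent_identity:
  assumes "z \<notin> op_spectrum A" "w \<notin> op_spectrum A"
  shows "resolvent_op A z y - resolvent_op A w y = scaleC (w - z) (resolvent_op A z (resolvent_op A w y))"
proof -
  let ?N = "\<lambda>z x. scaleC z x - A x" and ?R = "resolvent_op A"
  have z: "bij (?N z)" "bounded_clinear (?R z)" and w: "bij (?N w)"
    using assms by (auto simp: op_spectrum_def)
  interpret R: bounded_linear "?R z" using z(2) by (simp add: bounded_clinear_def)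
  let ?v = "?R w y"
  have y: "?N w ?v = y" unfolding resolvent_op_def by (rule surj_f_inv_f[OF bij_is_surj[OF w]])
  have "?v = ?R z (?N z ?v)" unfolding resolvent_op_def[of A z] using inv_f_f[OF bij_is_inj[OF z(1)], of ?v] by simp
  moreover have "?N z ?v = y - scaleC (w - z) ?v" using y by (simp add: scaleC_diff_left algebra_simps)
  ultimately have "?v = ?R z y - ?R z (scaleC (w - z) ?v)" by (metis R.diff)
  then show ?thesis using z(2) by (simp add: bounded_clinear_def algebra_simps)
qed

lemma norm_resolvent_le:
  assumes "z \<notin> op_spectrum A"
  shows "norm (resolvent_op A z y) \<le> onorm (resolvent_op A z) * norm y"
  using assms by (intro onorm) (simp add: op_spectrum_def bounded_clinear_def)

text \<open>The continuous majorant \<open>g\<close> bounds the resolvent near each point. The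
  resolvent identity then gives strong continuity, and a second use of it identifies the derivative
  at \<open>w\<close> as minus the matrix coefficient of the squared resolvent.\<close>

lemma holomorphic_cinner_resolvent:
  assumes "open \<Omega>" and spec: "\<Omega> \<inter> op_spectrum A = {}"
    and g: "continuous_on \<Omega> g" "\<And>z. z \<in> \<Omega> \<Longrightarrow> onorm (resolvent_op A z) \<le> g z"
  shows "(\<lambda>z. cinner x (resolvent_op A z y)) holomorphic_on \<Omega>"
proof (rule holomorphic_onI)
  fix w assume w: "w \<in> \<Omega>"
  let ?R = "resolvent_op A"
  have ev: "\<forall>\<^sub>F z in at w. z \<in> \<Omega>" using w \<open>open \<Omega>\<close> by (simp add: eventually_at_in_open')
  have R: "norm (?R z v) \<le> g z * norm v" if "z \<in> \<Omega>" for z v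
    using norm_resolvent_le[of z A v] g(2)[OF that] that spec
    by (meson disjoint_iff mult_right_mono norm_ge_zero order_trans)
  have "(g \<longlongrightarrow> g w) (at w)" using g(1) w \<open>open \<Omega>\<close> by (metis continuous_on_eq_continuous_at isCont_def)
  then have lim0: "((\<lambda>z. cmod (w - z) * (g z * C)) \<longlongrightarrow> cmod (w - w) * (g w * C)) (at w)" for C
    by (intro tendsto_intros)
  have lim: "((\<lambda>z. ?R z v - ?R w v) \<longlongrightarrow> 0) (at w)" for v
  proof (rule Lim_null_comparison)
    show "\<forall>\<^sub>F z in at w. norm (?R z v - ?R w v) \<le> cmod (w - z) * (g z * norm (?R w v))"
      using ev
    proof eventually_elim
      case (elim z)
      then have "?R z v - ?R w v = scaleC (w - z) (?R z (?R w v))"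
        using spec w by (intro resolvent_identity) auto
      then show ?case using R[OF elim, of "?R w v"] by (simp add: norm_scaleC mult_left_mono)
    qed
  qed (use lim0 in simp)
  \<comment> \<open>With this \<open>v\<close> the difference quotient equals
    \<open>- cinner x (?R z v)\<close> exactly, so strong continuity at the vector \<open>v\<close>
    is all that remains.\<close>
  define v where "v = ?R w y"
  have "((\<lambda>z. cinner x (?R z v - ?R w v)) \<longlongrightarrow> 0) (at w)"
  proof (rule Lim_null_comparison)
    show "\<forall>\<^sub>F z in at w. cmod (cinner x (?R z v - ?R w v)) \<le> norm x * norm (?R z v - ?R w v)"
      by (intro always_eventually allI cmod_cinner_le)
    show "((\<lambda>z. norm x * norm (?R z v - ?R w v)) \<longlongrightarrow> 0) (at w)"
      using tendsto_mult[OF tendsto_const tendsto_norm[OF lim]] by simp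
  qed
  from tendsto_minus[OF tendsto_add[OF this tendsto_const[of "cinner x (?R w v)"]]]
  have "((\<lambda>z. - cinner x (?R z v)) \<longlongrightarrow> - cinner x (?R w v)) (at w)" by (simp add: cinner_diff_right)
  moreover have "\<forall>\<^sub>F z in at w. - cinner x (?R z v) = (cinner x (?R z y) - cinner x (?R w y)) / (z - w)"
    using ev eventually_neq_at_within[of w w UNIV]
  proof eventually_elim
    case (elim z)
    have "cinner x (?R z y) - cinner x (?R w y) = (w - z) * cinner x (?R z v)"
      using elim spec w unfolding v_def cinner_diff_right[symmetric]
      by (subst resolvent_identity) (auto simp: cinner_scaleC_right)
    then show ?case using elim by (simp add: field_simps)
  qed
  ultimately have "((\<lambda>z. (cinner x (?R z y) - cinner x (?R w y)) / (z - w)) \<longlongrightarrow> - cinner x (?R w v)) (at w)"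
    by (rule Lim_transform_eventually)
  then have "((\<lambda>z. cinner x (?R z y)) has_field_derivative - cinner x (?R w v)) (at w)"
    by (simp add: has_field_derivative_iff)
  then show "(\<lambda>z. cinner x (?R z y)) field_differentiable at w within \<Omega>"
    by (meson field_differentiable_at_within field_differentiable_def)
qed

lemma holomorphic_minorant_of_onorm_resolvent:
  assumes A: "bounded_clinear A" and "open \<Omega>" and spec: "\<Omega> \<inter> op_spectrum A = {}"
    and g: "continuous_on \<Omega> g" "\<And>z. z \<in> \<Omega> \<Longrightarrow> onorm (resolvent_op A z) \<le> g z"
    and z0: "z0 \<in> \<Omega>" "onorm (resolvent_op A z0) \<ge> 1 / \<epsilon>" and "\<epsilon> > 0"
  obtains f where "f holomorphic_on \<Omega>" "\<And>z. z \<in> \<Omega> \<Longrightarrow> cmod (f z) \<le> onorm (resolvent_op A z)"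
    "1 / \<epsilon> \<le> cmod (f z0)"
proof -
  let ?R = "resolvent_op A"
  let ?N = "\<lambda>x. scaleC z0 x - A x"
  have bij: "bij ?N" using z0 spec by (auto simp: op_spectrum_def)
  have RN: "?R z0 (?N x) = x" for x
    unfolding resolvent_op_def using inv_f_f[OF bij_is_inj[OF bij], of x] by simp
  \<comment> \<open>Nearly extremal unit vectors; the slack tends to 0, so the sharp bound returns
    in the limit.\<close>
  have "\<exists>x. norm x = 1 \<and> norm (?N x) < \<epsilon> + inverse (real (Suc n))" for n
    using approx_eigenvector_of_onorm_resolvent[OF A _ z0(2) \<open>\<epsilon> > 0\<close>, of "\<epsilon> + inverse (real (Suc n))"] spec z0(1)
    by (metis disjoint_iff inverse_positive_iff_positive less_add_same_cancel1 of_nat_0_less_iff zero_less_Suc)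
  then obtain x where x: "\<And>n. norm (x n) = 1" "\<And>n. norm (?N (x n)) < \<epsilon> + inverse (real (Suc n))"
    by metis
  have y0: "norm (?N (x n)) > 0" for n
  proof -
    interpret R: bounded_linear "?R z0" using z0 spec by (auto simp: op_spectrum_def bounded_clinear_def)
    have "?N (x n) \<noteq> 0" using RN[of "x n"] x(1)[of n] R.zero by (metis norm_zero zero_neq_one)
    then show ?thesis by simp
  qed
  \<comment> \<open>Matrix coefficients between unit vectors, hence bounded by the resolvent norm.
    The second vector is chosen so that the resolvent at \<open>z0\<close> sends it to a multiple of
    \<open>x n\<close>, which makes \<open>F n z0\<close> nearly as large as that norm.\<close>
  define F where "F n z = cinner (x n) (?R z (?N (x n))) / of_real (norm (?N (x n)))" for n z
  define H where "H = {h. h holomorphic_on \<Omega> \<and> (\<forall>z\<in>\<Omega>. cmod (h z) \<le> onorm (?R z))}"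
  have F: "F n \<in> H" for n
  proof -
    have "F n holomorphic_on \<Omega>" unfolding F_def using y0[of n]
      by (intro holomorphic_intros holomorphic_cinner_resolvent[OF \<open>open \<Omega>\<close> spec g]) auto
    moreover have "cmod (F n z) \<le> onorm (?R z)" if "z \<in> \<Omega>" for z
    proof -
      have "cmod (cinner (x n) (?R z (?N (x n)))) \<le> norm (x n) * norm (?R z (?N (x n)))"
        by (rule cmod_cinner_le)
      also have "\<dots> \<le> onorm (?R z) * norm (?N (x n))"
        using norm_resolvent_le[of z A "?N (x n)"] that spec x(1) by auto
      finally show ?thesis using y0[of n] by (simp add: F_def norm_divide field_simps)
    qed
    ultimately show ?thesis by (simp add: H_def)
  qed
  \<comment> \<open>Local boundedness, as Montel's theorem requires; it comes from the continuous
    \<open>g\<close>, as continuity of the resolvent norm itself is not established.\<close>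
  have bounded: "\<exists>B. \<forall>h\<in>H. \<forall>z\<in>K. cmod (h z) \<le> B" if K: "compact K" "K \<subseteq> \<Omega>" for K
  proof -
    have "bounded (g ` K)"
      using K g(1) by (metis compact_continuous_image compact_imp_bounded continuous_on_subset)
    then obtain B where B: "\<And>z. z \<in> K \<Longrightarrow> \<bar>g z\<bar> \<le> B" by (auto simp: bounded_iff)
    have "cmod (h z) \<le> B" if "h \<in> H" "z \<in> K" for h z
    proof -
      have "cmod (h z) \<le> onorm (?R z)" using that K by (auto simp: H_def)
      also have "\<dots> \<le> g z" using that K g(2) by auto
      also have "\<dots> \<le> B" using B[OF that(2)] by simp
      finally show ?thesis .
    qed
    then show ?thesis by blast
  qed
  obtain f r where f: "f holomorphic_on \<Omega>" and r: "strict_mono (r :: nat \<Rightarrow> nat)"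
    and lim: "\<And>z. z \<in> \<Omega> \<Longrightarrow> (\<lambda>n. F (r n) z) \<longlonglongrightarrow> f z"
    by (rule Montel[OF \<open>open \<Omega>\<close>, of H F]) (use F bounded in \<open>auto simp: H_def\<close>)
  have "cmod (f z) \<le> onorm (?R z)" if "z \<in> \<Omega>" for z
    by (rule LIMSEQ_le_const2[OF tendsto_norm[OF lim[OF that]]]) (use F that in \<open>auto simp: H_def\<close>)
  moreover have "1 / \<epsilon> \<le> cmod (f z0)"
  proof (rule LIMSEQ_le)
    have "(\<lambda>n. inverse (real (Suc (r n)))) \<longlonglongrightarrow> 0"
      using LIMSEQ_subseq_LIMSEQ[OF LIMSEQ_inverse_real_of_nat r] by (simp add: o_def)
    then have "(\<lambda>n. 1 / (\<epsilon> + inverse (real (Suc (r n))))) \<longlonglongrightarrow> 1 / (\<epsilon> + 0)"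
      using \<open>\<epsilon> > 0\<close> by (intro tendsto_intros) auto
    then show "(\<lambda>n. 1 / (\<epsilon> + inverse (real (Suc (r n))))) \<longlonglongrightarrow> 1 / \<epsilon>" by simp
    show "(\<lambda>n. cmod (F (r n) z0)) \<longlonglongrightarrow> cmod (f z0)" by (intro tendsto_norm lim z0)
    have "1 / (\<epsilon> + inverse (real (Suc n))) \<le> cmod (F n z0)" for n
    proof -
      have "Re (cinner (x n) (x n)) = 1" by (simp add: Re_cinner x(1) flip: power2_norm_eq_inner)
      then have "1 \<le> cmod (cinner (x n) (x n))" by (metis complex_Re_le_cmod)
      then have "1 / norm (?N (x n)) \<le> cmod (F n z0)"
        using y0[of n] by (simp add: F_def RN norm_divide divide_right_mono)
      moreover have "1 / (\<epsilon> + inverse (real (Suc n))) \<le> 1 / norm (?N (x n))"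
        using y0[of n] x(2)[of n] \<open>\<epsilon> > 0\<close> by (intro divide_left_mono mult_pos_pos add_pos_pos) auto
      ultimately show ?thesis by simp
    qed
    then show "\<exists>N. \<forall>n\<ge>N. 1 / (\<epsilon> + inverse (real (Suc (r n)))) \<le> cmod (F (r n) z0)" by blast
  qed
  ultimately show ?thesis using that f by blast
qed

section \<open>Laurent and Jacobi operators on the integers\<close>

text \<open>A geometric sum over roots of unity; the bound on \<open>j\<close> makes 0 the only
  multiple of \<open>N\<close> in range.\<close>

lemma sum_cis_roots_of_unity:
  fixes j :: int
  assumes "\<bar>j\<bar> < int N"
  shows "(\<Sum>k<N. cis (2 * pi * real k * j / N)) = (if j = 0 then of_nat N else 0)"
proof (cases "j = 0")
  case False
  have N: "N > 0" using assms by auto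
  let ?x = "cis (2 * pi * j / N)"
  have "?x \<noteq> 1"
  proof
    assume "?x = 1"
    then have "cos (2 * pi * j / N) = 1" by (metis cis.simps(1) one_complex.simps(1))
    then obtain m :: int where "2 * pi * j / N = m * 2 * pi" by (auto simp: cos_one_2pi_int)
    then have "real_of_int j = real_of_int (m * int N)" using N by (simp add: field_simps)
    then have "j = m * int N" by linarith
    then show False using assms False by (simp add: abs_mult)
  qed
  moreover have "real N * (2 * pi * j / N) = 2 * pi * j" using N by simp
  then have "?x ^ N = 1" using cis_multiple_2pi[of "of_int j"] by (simp only: Complex.DeMoivre Ints_of_int) 
  ultimately have "(\<Sum>k<N. ?x ^ k) = 0" by (simp add: geometric_sum)
  then show ?thesis using False by (simp add: Complex.DeMoivre mult_ac)
qed simp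

text \<open>Expanding the squares and summing over \<open>k\<close> first leaves the diagonal terms
  by orthogonality, since two indices in a window of length \<open>N\<close> differ by less than
  \<open>N\<close>.\<close>

lemma discrete_parseval:
  fixes h :: "int \<Rightarrow> complex"
  assumes I: "I = {A..<A + int N}"
  shows "(\<Sum>k<N. (cmod (\<Sum>n\<in>I. h n * cis (- (2 * pi * real k * n / N))))\<^sup>2) = N * (\<Sum>n\<in>I. (cmod (h n))\<^sup>2)"
proof -
  define e where "e k n = cis (- (2 * pi * real k * real_of_int n / N))" for k n
  have e: "e k n * cnj (e k m) = cis (2 * pi * real k * real_of_int (m - n) / N)" for k n m
    by (simp add: e_def cis_cnj cis_mult ring_distribs diff_divide_distrib)
  have "complex_of_real (\<Sum>k<N. (cmod (\<Sum>n\<in>I. h n * e k n))\<^sup>2)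
      = (\<Sum>k<N. \<Sum>n\<in>I. \<Sum>m\<in>I. h n * cnj (h m) * (e k n * cnj (e k m)))"
    by (simp only: of_real_sum complex_norm_square cnj_sum sum_product complex_cnj_mult mult_ac)
  also have "\<dots> = (\<Sum>n\<in>I. \<Sum>k<N. \<Sum>m\<in>I. h n * cnj (h m) * (e k n * cnj (e k m)))"
    by (rule sum.swap)
  also have "\<dots> = (\<Sum>n\<in>I. \<Sum>m\<in>I. \<Sum>k<N. h n * cnj (h m) * (e k n * cnj (e k m)))"
    by (intro sum.cong refl sum.swap)
  also have "\<dots> = (\<Sum>n\<in>I. \<Sum>m\<in>I. if m = n then of_nat N * (h n * cnj (h n)) else 0)"
    unfolding e sum_distrib_left[symmetric]
    by (intro sum.cong refl, subst sum_cis_roots_of_unity) (auto simp: I)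
  also have "\<dots> = (\<Sum>n\<in>I. of_nat N * (h n * cnj (h n)))"
    by (simp add: sum.delta I)
  also have "\<dots> = complex_of_real (N * (\<Sum>n\<in>I. (cmod (h n))\<^sup>2))"
    by (simp only: of_real_mult of_real_of_nat_eq of_real_sum complex_norm_square sum_distrib_left)
  finally show ?thesis unfolding e_def by (simp only: of_real_eq_iff)
qed

lemma norm_ell2_finite_support:
  assumes "finite F" "\<And>i. i \<notin> F \<Longrightarrow> coord u i = 0"
  shows "(norm u)\<^sup>2 = (\<Sum>i\<in>F. (cmod (coord u i))\<^sup>2)"
proof -
  have "(\<Sum>\<^sub>\<infinity>i. (cmod (coord u i))\<^sup>2) = (\<Sum>\<^sub>\<infinity>i\<in>F. (cmod (coord u i))\<^sup>2)"
    by (rule infsum_cong_neutral) (use assms in auto)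
  then show ?thesis using assms(1) by (simp add: norm_ell2_eq sum_nonneg)
qed

lemma square_summable_finite_support:
  assumes "finite F" "\<And>i. i \<notin> F \<Longrightarrow> f i = 0"
  shows "square_summable f"
proof -
  have "(\<lambda>i. (cmod (f i))\<^sup>2) summable_on F" using assms(1) by simp
  then show ?thesis unfolding square_summable_def
    by (rule summable_on_cong_neutral[THEN iffD1, rotated -1]) (use assms in auto)
qed

lemma ell2_finite_support_dense:
  fixes u :: "int ell2"
  assumes "e > 0"
  obtains v M where "\<And>n. n \<notin> {-M..M} \<Longrightarrow> coord v n = 0" "norm (u - v) < e"
proof -
  let ?s = "\<lambda>i. (cmod (coord u i))\<^sup>2"
  have s: "?s summable_on UNIV" using square_summable_coord[of u] by (simp add: square_summable_def)
  have "(sum ?s \<longlongrightarrow> infsum ?s UNIV) (finite_subsets_at_top UNIV)"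
    using has_sum_infsum[OF s] by (simp add: has_sum_def)
  then have "\<forall>\<^sub>F F in finite_subsets_at_top UNIV. dist (sum ?s F) (infsum ?s UNIV) < e\<^sup>2"
    by (rule tendstoD) (use assms in simp)
  then obtain F where F: "finite F" "dist (sum ?s F) (infsum ?s UNIV) < e\<^sup>2"
    unfolding eventually_finite_subsets_at_top by (metis subset_UNIV subset_refl)
  define v where "v = Abs_ell2 (\<lambda>i. if i \<in> F then coord u i else 0)"
  have v: "coord v i = (if i \<in> F then coord u i else 0)" for i
    unfolding v_def by (subst coord_Abs_ell2[OF square_summable_finite_support[OF F(1)]]) auto
  \<comment> \<open>A crude radius of a symmetric interval containing \<open>F\<close>.\<close>
  define M where "M = (\<Sum>x\<in>F. \<bar>x\<bar>)"
  have "\<bar>x\<bar> \<le> M" if "x \<in> F" for x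
    unfolding M_def by (rule member_le_sum) (use that F in auto)
  then have "coord v n = 0" if "n \<notin> {-M..M}" for n using that by (force simp: v)
  moreover have "norm (u - v) < e"
  proof -
    have "infsum ?s (F \<union> -F) = infsum ?s F + infsum ?s (-F)"
      by (intro infsum_Un_disjoint summable_on_subset_banach[OF s]) auto
    moreover have "(\<Sum>\<^sub>\<infinity>i. (cmod (coord (u - v) i))\<^sup>2) = infsum ?s (-F)"
      by (rule infsum_cong_neutral) (auto simp: v)
    ultimately have "(\<Sum>\<^sub>\<infinity>i. (cmod (coord (u - v) i))\<^sup>2) < e\<^sup>2"
      using F by (simp add: dist_real_def)
    then show ?thesis using assms unfolding norm_ell2_eq by (simp add: real_less_lsqrt infsum_nonneg)
  qed
  ultimately show ?thesis by (rule that)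
qed

lemma periodic_seq_const: "periodic_seq p (\<lambda>_. r)"
  by (simp add: periodic_seq_def)

lemmas coord_jacobi_const = coord_jacobi[OF periodic_seq_const periodic_seq_const periodic_seq_const zero_less_one]
lemmas bounded_clinear_jacobi_const = bounded_clinear_jacobi[OF periodic_seq_const periodic_seq_const periodic_seq_const zero_less_one]

lemma bounded_linear_scaleC: "bounded_linear (scaleC z)" for z :: complex
  by (rule bounded_linear_intro[of _ "cmod z"])
    (auto simp: scaleC_add_right norm_scaleC simp flip: scaleC_of_real, auto simp: scaleC_scaleC mult.commute)

lemma bounded_linear_shifted: "bounded_clinear A \<Longrightarrow> bounded_linear (\<lambda>x. scaleC z x - A x)"
  unfolding bounded_clinear_def by (intro bounded_linear_sub bounded_linear_scaleC) auto

section \<open>Laurent operators and their symbol\<close>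

lemma laurent_bounded_below_finite_support:
  fixes \<alpha> \<beta> \<gamma> :: real and u :: "int ell2"
  assumes d: "\<And>x :: complex. cmod x = 1 \<Longrightarrow> d \<le> cmod (z - (\<alpha> + \<beta> * x + \<gamma> * cnj x))" "0 \<le> d"
    and supp: "\<And>n. n \<notin> {-M..M} \<Longrightarrow> coord u n = 0" 
  shows "d * norm u \<le> norm (scaleC z u - jacobi (\<lambda>_. \<alpha>) (\<lambda>_. \<beta>) (\<lambda>_. \<gamma>) u)"
proof (cases "M \<ge> 0")
  case False
  then have "u = 0" using supp by (intro ell2_eqI) simp
  then show ?thesis by simp
next
  case True
  define g where "g = scaleC z u - jacobi (\<lambda>_. \<alpha>) (\<lambda>_. \<beta>) (\<lambda>_. \<gamma>) u"
  \<comment> \<open>The operator widens the support by one site on each side, so \<open>I\<close> is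
    the interval from -M-1 to M+1, of 2M+3 sites; on it no cyclic wrap-around occurs.\<close>
  define N where "N = nat (2 * M + 3)"
  define I where "I = {-M-1..<-M-1 + int N}"
  have N: "N > 0" "int N = 2 * M + 3" using True by (auto simp: N_def)
  have finI: "finite I" by (simp add: I_def)
  have g: "coord g n = (z - \<alpha>) * coord u n - \<beta> * coord u (n + 1) - \<gamma> * coord u (n - 1)" for n
    by (simp add: g_def coord_jacobi_const algebra_simps)
  define F where "F k v = (\<Sum>n\<in>I. coord v n * cis (- (2 * pi * real k * n / N)))" for k and v :: "int ell2"
  have normF: "(\<Sum>k<N. (cmod (F k v))\<^sup>2) = N * (norm v)\<^sup>2" if "\<And>n. n \<notin> I \<Longrightarrow> coord v n = 0" for v
    unfolding F_def discrete_parseval[OF I_def] by (simp add: norm_ell2_finite_support[OF finI that])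
  \<comment> \<open>\<open>u\<close> and \<open>g\<close> are supported in one period \<open>I\<close>, so the discrete Fourier transform \<open>F\<close> turns the
    operator into multiplication by its symbol at roots of unity.\<close>
  have F: "d * cmod (F k u) \<le> cmod (F k g)" for k
  proof -
    define e where "e n = cis (- (2 * pi * real k * real_of_int n / N))" for n
    define x where "x = cis (2 * pi * real k / N)"
    have e: "e (n - 1) = x * e n" "e (n + 1) = cnj x * e n" for n
      by (simp_all add: e_def x_def cis_cnj cis_mult diff_divide_distrib add_divide_distrib algebra_simps)
    \<comment> \<open>Reindexing by \<open>s\<close>: the indices of \<open>I\<close> that leave the
      support contribute zero, and \<open>m - s\<close> stays in \<open>I\<close> because
      \<open>I\<close> has one spare site at each end.\<close>
    have shift: "(\<Sum>n\<in>I. coord u (n + s) * e n) = (\<Sum>m\<in>{-M..M}. coord u m * e (m - s))" if "\<bar>s\<bar> \<le> 1" for s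
      by (rule sum.reindex_bij_witness_not_neutral[where S' = "{n \<in> I. n + s \<notin> {-M..M}}" and T' = "{}"
            and i = "\<lambda>m. m - s" and j = "\<lambda>n. n + s"],
          rule finite_subset[OF _ finI])
        (use that supp N in \<open>auto simp: I_def\<close>)
    have "F k g = (z - \<alpha>) * (\<Sum>n\<in>I. coord u (n + 0) * e n) - \<beta> * (\<Sum>n\<in>I. coord u (n + 1) * e n)
        - \<gamma> * (\<Sum>n\<in>I. coord u (n + (-1)) * e n)"
      unfolding F_def g e_def[symmetric] sum_distrib_left sum_subtractf[symmetric]
      by (simp add: algebra_simps)
    also have "\<dots> = (z - (\<alpha> + \<beta> * x + \<gamma> * cnj x)) * (\<Sum>n\<in>I. coord u (n + 0) * e n)"
      by (simp only: shift abs_zero abs_one abs_minus_cancel zero_le_one order_refl diff_minus_eq_add e diff_0_right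
          mult.left_commute[of _ x] mult.left_commute[of _ "cnj x"] sum_distrib_left[symmetric])
        (simp add: algebra_simps)
    also have "(\<Sum>n\<in>I. coord u (n + 0) * e n) = F k u" by (simp add: F_def e_def)
    finally show ?thesis
      using d(1)[of x] by (simp add: norm_mult mult_right_mono x_def)
  qed
  have "N * (d * norm u)\<^sup>2 = (\<Sum>k<N. (d * cmod (F k u))\<^sup>2)"
  proof -
    have "coord u n = 0" if "n \<notin> I" for n by (rule supp) (use that N in \<open>auto simp: I_def\<close>)
    from normF[OF this] show ?thesis by (simp add: power_mult_distrib sum_distrib_left[symmetric])
  qed
  also have "\<dots> \<le> (\<Sum>k<N. (cmod (F k g))\<^sup>2)"
    by (intro sum_mono power_mono F) (use d(2) in auto)
  also have "\<dots> = N * (norm g)\<^sup>2"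
    by (rule normF) (use supp N in \<open>auto simp: g I_def\<close>)
  finally have "(d * norm u)\<^sup>2 \<le> (norm g)\<^sup>2" using N(1) by simp
  then show ?thesis unfolding g_def[symmetric] by (rule power2_le_imp_le) simp
qed

text \<open>Both sides are continuous in \<open>u\<close>, so the bound extends from the dense set
  of finitely supported vectors.\<close>

lemma laurent_bounded_below:
  fixes \<alpha> \<beta> \<gamma> :: real
  assumes d: "\<And>x :: complex. cmod x = 1 \<Longrightarrow> d \<le> cmod (z - (\<alpha> + \<beta> * x + \<gamma> * cnj x))" "0 \<le> d"
  shows "d * norm u \<le> norm (scaleC z u - jacobi (\<lambda>_. \<alpha>) (\<lambda>_. \<beta>) (\<lambda>_. \<gamma>) u)"
proof -
  have "\<exists>v M. (\<forall>n. n \<notin> {-M..M} \<longrightarrow> coord v n = 0) \<and> norm (u - v) < inverse (Suc k)" for k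
    using ell2_finite_support_dense[of "inverse (Suc k)" u] by (metis inverse_positive_iff_positive of_nat_0_less_iff zero_less_Suc)
  then obtain V M where V: "\<And>k n. n \<notin> {-M k..M k} \<Longrightarrow> coord (V k) n = 0" "\<And>k. norm (u - V k) < inverse (Suc k)"
    by metis
  have "(\<lambda>k. u - V k) \<longlonglongrightarrow> 0"
    by (rule Lim_null_comparison[OF _ LIMSEQ_inverse_real_of_nat])
      (use V(2) in \<open>auto intro!: always_eventually less_imp_le\<close>)
  from tendsto_diff[OF tendsto_const[of u] this] have lim: "V \<longlonglongrightarrow> u" by simp
  let ?N = "\<lambda>u. scaleC z u - jacobi (\<lambda>_. \<alpha>) (\<lambda>_. \<beta>) (\<lambda>_. \<gamma>) u"
  have "(\<lambda>k. ?N (V k)) \<longlonglongrightarrow> ?N u"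
    by (rule bounded_linear.tendsto[OF bounded_linear_shifted[OF bounded_clinear_jacobi_const] lim])
  then show ?thesis
    by (intro LIMSEQ_le[OF tendsto_mult[OF tendsto_const tendsto_norm[OF lim]] tendsto_norm])
      (use laurent_bounded_below_finite_support[OF d V(1)] in auto)
qed

text \<open>A plane wave cut off to \<open>M\<close> sites: its squared norm is \<open>M\<close>,
  while the defect lives on four sites near the two ends and stays bounded as \<open>M\<close>
  grows.\<close>

lemma laurent_approx_eigenvector:
  fixes \<alpha> \<beta> \<gamma> :: real and x :: complex
  assumes x: "cmod x = 1" and "\<eta> > 0"
  obtains u where "u \<noteq> 0"
    "norm (scaleC (\<alpha> + \<beta> * x + \<gamma> * cnj x) u - jacobi (\<lambda>_. \<alpha>) (\<lambda>_. \<beta>) (\<lambda>_. \<gamma>) u) \<le> \<eta> * norm u"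
proof -
  define K where "K = 2 * (\<bar>\<beta>\<bar> + \<bar>\<gamma>\<bar>)"
  obtain M0 :: nat where M0: "4 * K\<^sup>2 / \<eta>\<^sup>2 \<le> M0" using real_arch_simple[of "4 * K\<^sup>2 / \<eta>\<^sup>2"] by blast
  define M where "M = M0 + 2"
  have M: "4 * K\<^sup>2 \<le> \<eta>\<^sup>2 * M" "M \<ge> 2"
    using M0 \<open>\<eta> > 0\<close> by (auto simp: M_def field_simps add_increasing2)
  define u where "u = Abs_ell2 (\<lambda>n. if n \<in> {0..<int M} then x ^ nat n else 0)"
  have u: "coord u n = (if n \<in> {0..<int M} then x ^ nat n else 0)" for n
    unfolding u_def by (subst coord_Abs_ell2[OF square_summable_finite_support[of "{0..<int M}"]]) auto
  have normu: "(norm u)\<^sup>2 = M"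
    by (subst norm_ell2_finite_support[of "{0..<int M}"]) (auto simp: u norm_power x)
  have u1: "cmod (coord u n) \<le> 1" for n by (simp add: u norm_power x)
  define g where "g = scaleC (\<alpha> + \<beta> * x + \<gamma> * cnj x) u - jacobi (\<lambda>_. \<alpha>) (\<lambda>_. \<beta>) (\<lambda>_. \<gamma>) u"
  have g: "coord g n = (\<beta> * x + \<gamma> * cnj x) * coord u n - \<beta> * coord u (n + 1) - \<gamma> * coord u (n - 1)" for n
    by (simp add: g_def coord_jacobi_const algebra_simps)
  have bound: "cmod (coord g n) \<le> K" for n
  proof -
    have "cmod ((\<beta> * x + \<gamma> * cnj x) * coord u n) \<le> (\<bar>\<beta>\<bar> + \<bar>\<gamma>\<bar>) * 1"
      unfolding norm_mult by (intro mult_mono u1 norm_triangle_le) (auto simp: norm_mult x)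
    moreover have "cmod (\<beta> * coord u (n + 1)) \<le> \<bar>\<beta>\<bar>" "cmod (\<gamma> * coord u (n - 1)) \<le> \<bar>\<gamma>\<bar>"
      by (auto simp: norm_mult intro: mult_left_le u1)
    ultimately show ?thesis unfolding g K_def
      by (smt (verit) norm_triangle_ineq4)
  qed
  \<comment> \<open>On the unit circle \<open>cnj x\<close> is the inverse of \<open>x\<close>,
    which is why the interior terms cancel.\<close>
  have xx: "cnj x * x = 1" using x by (simp add: mult.commute complex_norm_square[symmetric])
  have supp: "coord g n = 0" if "n \<notin> {-1, 0, int M - 1, int M}" for n
  proof (cases "1 \<le> n \<and> n \<le> int M - 2")
    case True
    then obtain k where k: "n = int (Suc k)" by (metis Suc_pred' nat_eq_iff2 zero_less_imp_eq_int int_one_le_iff_zero_less)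
    have "nat (n + 1) = Suc (Suc k)" "nat (n - 1) = k" "nat n = Suc k" using k by auto
    then show ?thesis using True xx by (simp add: g u algebra_simps)
  next
    case False
    then show ?thesis using that by (auto simp: g u)
  qed
  have "(norm g)\<^sup>2 = (\<Sum>n\<in>{-1, 0, int M - 1, int M}. (cmod (coord g n))\<^sup>2)"
    by (rule norm_ell2_finite_support) (use supp in auto)
  also have "\<dots> \<le> of_nat (card {-1, 0, int M - 1, int M}) * K\<^sup>2"
    by (intro sum_bounded_above power_mono bound) auto
  also have "\<dots> \<le> 4 * K\<^sup>2"
    by (intro mult_right_mono) (auto simp: card_insert_if)
  also have "\<dots> \<le> (\<eta> * norm u)\<^sup>2" using M by (simp add: power_mult_distrib normu)
  finally have "norm g \<le> \<eta> * norm u" by (rule power2_le_imp_le) (use \<open>\<eta> > 0\<close> in simp)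
  moreover have "u \<noteq> 0" using normu M by auto
  ultimately show ?thesis using that unfolding g_def by blast
qed

section \<open>Adjoints and diagonal perturbations\<close>

lemma summable_on_jacobi_term:
  fixes u v :: "int ell2" and d :: "int \<Rightarrow> real"
  assumes "\<And>n. \<bar>d n\<bar> \<le> B"
  shows "(\<lambda>n. of_real (d n) * (cnj (coord u (n + j)) * coord v (n + k))) summable_on UNIV"
proof -
  have "square_summable (\<lambda>n. complex_of_real (d n) * coord u (n + j))"
    by (rule square_summable_bounded_mult[OF square_summable_reindex[OF square_summable_coord bij_plus_int], of _ B])
      (simp add: assms)
  from square_summable_cinner[OF this square_summable_reindex[OF square_summable_coord bij_plus_int[of k]], of v]
  show ?thesis by (simp add: mult_ac)
qed

text \<open>The coefficients are real, so the adjoint is the transpose, which exchanges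
  \<open>b\<close> and \<open>c\<close>. Shifting the index by one in each off-diagonal series turns
  one form into the other.\<close>

lemma cinner_jacobi:
  assumes a: "periodic_seq p a" and b: "periodic_seq p b" and c: "periodic_seq p c" and p: "p > 0"
  shows "cinner (jacobi a b c u) v = cinner u (jacobi a c b v)"
proof -
  obtain A B C where A: "\<And>i. \<bar>a i\<bar> \<le> A" and B: "\<And>i. \<bar>b i\<bar> \<le> B" and C: "\<And>i. \<bar>c i\<bar> \<le> C"
    using periodic_seq_bounded[OF a p] periodic_seq_bounded[OF b p] periodic_seq_bounded[OF c p] by metis
  let ?t = "\<lambda>d j k n. complex_of_real (d n) * (cnj (coord u (n + j)) * coord v (n + k))"
  note S = summable_on_jacobi_term[OF A] summable_on_jacobi_term[OF B] summable_on_jacobi_term[OF C]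
    summable_on_jacobi_term[of "\<lambda>n. b (n - 1)", OF B] summable_on_jacobi_term[of "\<lambda>n. c (n - 1)", OF C]
  have "cinner (jacobi a b c u) v = (\<Sum>\<^sub>\<infinity>n. ?t (\<lambda>n. c (n - 1)) (-1) 0 n + ?t a 0 0 n + ?t b 1 0 n)"
    unfolding cinner_ell2_def by (intro infsum_cong) (simp add: coord_jacobi[OF a b c p] algebra_simps)
  also have "\<dots> = (\<Sum>\<^sub>\<infinity>n. ?t (\<lambda>n. c (n - 1)) (-1) 0 n) + (\<Sum>\<^sub>\<infinity>n. ?t a 0 0 n) + (\<Sum>\<^sub>\<infinity>n. ?t b 1 0 n)"
    by (simp only: infsum_add S summable_on_add)
  also have "(\<Sum>\<^sub>\<infinity>n. ?t (\<lambda>n. c (n - 1)) (-1) 0 n) = (\<Sum>\<^sub>\<infinity>n. ?t c 0 1 n)"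
    using infsum_reindex_bij_betw[OF bij_plus_int[of 1], of "?t (\<lambda>n. c (n - 1)) (-1) 0"] by (simp add: add.commute)
  also have "(\<Sum>\<^sub>\<infinity>n. ?t b 1 0 n) = (\<Sum>\<^sub>\<infinity>n. ?t (\<lambda>n. b (n - 1)) 0 (-1) n)"
    using infsum_reindex_bij_betw[OF bij_plus_int[of 1], of "?t (\<lambda>n. b (n - 1)) 0 (-1)"] by (simp add: add.commute)
  also have "(\<Sum>\<^sub>\<infinity>n. ?t c 0 1 n) + (\<Sum>\<^sub>\<infinity>n. ?t a 0 0 n) + (\<Sum>\<^sub>\<infinity>n. ?t (\<lambda>n. b (n - 1)) 0 (-1) n)
      = (\<Sum>\<^sub>\<infinity>n. ?t c 0 1 n + ?t a 0 0 n + ?t (\<lambda>n. b (n - 1)) 0 (-1) n)"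
    by (simp only: infsum_add S summable_on_add)
  also have "\<dots> = cinner u (jacobi a c b v)"
    unfolding cinner_ell2_def by (intro infsum_cong) (simp add: coord_jacobi[OF a c b p] algebra_simps)
  finally show ?thesis .
qed

text \<open>The off-diagonal terms cancel and leave multiplication by a bounded sequence.\<close>

lemma norm_jacobi_diff_le:
  assumes "periodic_seq p a" "periodic_seq p a'" "periodic_seq p b" "periodic_seq p c" "p > 0"
    and "\<And>n. \<bar>a n - a' n\<bar> \<le> \<omega>"
  shows "norm (jacobi a b c u - jacobi a' b c u) \<le> \<omega> * norm u"
proof -
  have "jacobi a b c u - jacobi a' b c u = Abs_ell2 (\<lambda>n. of_real (a n - a' n) * coord u n)"
  proof (rule ell2_eqI)
    have "square_summable (\<lambda>n. of_real (a n - a' n) * coord u n)"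
      by (rule square_summable_bounded_mult[of _ _ \<omega>]) (use assms(6) in \<open>simp_all only: norm_of_real square_summable_coord\<close>)
    then show "coord (jacobi a b c u - jacobi a' b c u) i = coord (Abs_ell2 (\<lambda>n. of_real (a n - a' n) * coord u n)) i" for i
      using assms by (simp add: coord_Abs_ell2 coord_jacobi algebra_simps)
  qed
  then show ?thesis
    using norm_Abs_ell2_bounded_mult[of "coord u" "\<lambda>n. of_real (a n - a' n)" \<omega>] assms(6)
    by (simp add: coord_inverse flip: of_real_diff)
qed

section \<open>Path components of superlevel sets of holomorphic functions\<close>

lemma escape_to_neighbourhood_of_complement:
  fixes f :: "complex \<Rightarrow> complex"
  assumes hol: "f holomorphic_on \<Omega>" and "open \<Omega>" "open U" and cover: "\<Omega> \<union> U = UNIV"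
    and decay: "\<And>e. e > 0 \<Longrightarrow> \<exists>B. \<forall>z\<in>\<Omega>. cmod z > B \<longrightarrow> cmod (f z) < e"
    and z0: "z0 \<in> \<Omega>" "f z0 \<noteq> 0"
  obtains w where "w \<in> U" "path_component ({z\<in>\<Omega>. cmod (f z0) \<le> cmod (f z)} \<union> U) z0 w"
proof -
  define c where "c = cmod (f z0)"
  define S where "S = {z\<in>\<Omega>. c \<le> cmod (f z)} \<union> U"
  define C where "C = connected_component_set \<Omega> z0"
  have c: "c > 0" using z0 by (simp add: c_def)
  have C: "open C" "connected C" "C \<subseteq> \<Omega>" "z0 \<in> C"
    using \<open>open \<Omega>\<close> z0 by (auto simp: C_def open_connected_component connected_component_subset)
  have cont: "continuous_on \<Omega> f" using hol holomorphic_on_imp_continuous_on by blast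
  \<comment> \<open>An open set that misses \<open>X\<close> also misses its closure; the rest is
    the covering hypothesis. Closures inside \<Omega> keep \<open>f\<close> defined on
    frontiers.\<close>
  have disj: "closure X \<subseteq> \<Omega>" if "X \<inter> U = {}" for X
    using open_Int_closure_eq_empty[OF \<open>open U\<close>, of X] that cover by blast
  \<comment> \<open>Components of an open set are open and pairwise disjoint, so a frontier point
    inside \<open>W\<close> would lie in a second component that meets the first.\<close>
  have frontier_component: "frontier (connected_component_set W x) \<inter> W = {}" if W: "open W" for W :: "complex set" and x
  proof (rule ccontr)
    assume "\<not> ?thesis"
    then obtain y where y: "y \<in> closure (connected_component_set W x)" "y \<in> W"
        "y \<notin> connected_component_set W x"
      using open_connected_component[OF W, of x] by (auto simp: frontier_def interior_open)
    have "open (connected_component_set W y)" "y \<in> connected_component_set W y"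
      using W y by (auto simp: open_connected_component)
    then have "connected_component_set W y \<inter> connected_component_set W x \<noteq> {}"
      using y(1) by (metis IntI closure_iff_nhds_not_empty empty_iff order_refl Int_commute)
    then show False
      using y(3) by (metis connected_component_disjoint)
  qed
  have "\<exists>w\<in>U. path_component S z0 w"
  proof (cases "f constant_on C")
    case True
    then have const: "f z = f z0" if "z \<in> C" for z
      using that C(4) by (auto simp: constant_on_def)
    \<comment> \<open>Otherwise \<open>C\<close> would have empty frontier and be the whole plane,
      and a nonzero constant does not decay.\<close>
    have "C \<inter> U \<noteq> {}"
    proof
      assume "C \<inter> U = {}"
      then have "closure C \<subseteq> \<Omega>" by (rule disj)
      then have "frontier C = {}"
        using frontier_component[OF \<open>open \<Omega>\<close>, of z0] by (auto simp: C_def frontier_def)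
      then have "C = UNIV" using C(4) frontier_eq_empty by blast
      moreover obtain B where "\<forall>z\<in>\<Omega>. cmod z > B \<longrightarrow> cmod (f z) < c" using decay[OF c] by blast
      moreover have "cmod (of_real (\<bar>B\<bar> + 1)) > B"
        unfolding norm_of_real by arith
      ultimately show False
        using const[of "of_real (\<bar>B\<bar> + 1)"] C(3) unfolding c_def by (metis UNIV_I less_irrefl subset_iff)
    qed
    then obtain w where w: "w \<in> C" "w \<in> U" by blast
    have "path_component C z0 w"
      using C w by (metis connected_open_path_connected path_connected_component)
    moreover have "C \<subseteq> S" using C(3) const by (auto simp: S_def c_def)
    ultimately show ?thesis using w path_component_of_subset by blast
  next
    case False
    have hol': "(\<lambda>z. f z - f z0) holomorphic_on C"
      using hol C(3) by (intro holomorphic_intros) (auto intro: holomorphic_on_subset)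
    have nc: "\<not> (\<lambda>z. f z - f z0) constant_on C"
      using False by (auto simp: constant_on_def) (metis diff_add_cancel)
    obtain g r n where n: "0 < n" "0 < r" "ball z0 r \<subseteq> C" "g holomorphic_on ball z0 r"
      and g: "\<And>w. w \<in> ball z0 r \<Longrightarrow> f w - f z0 = (w - z0) ^ n * g w" "\<And>w. w \<in> ball z0 r \<Longrightarrow> g w \<noteq> 0"
      by (rule holomorphic_factor_zero_nonconstant[OF hol' C(1,2,4) diff_self nc]) (rule that; assumption)
    \<comment> \<open>A direction of steepest growth: multiplied by \<open>cnj (f z0)\<close>, the
      leading term of \<open>f (z0 + t * \<delta>) - f z0\<close> becomes \<open>t ^ n\<close> times
      the positive number \<open>(cmod (f z0))\<^sup>2 * (cmod (g z0))\<^sup>2\<close>.\<close>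
    obtain \<delta> where \<delta>: "\<delta> ^ n = f z0 * cnj (g z0)"
      using exists_complex_root[of n "f z0 * cnj (g z0)"] n(1) by (metis less_irrefl)
    define P where "P t = Re (cnj (f z0) * (\<delta> ^ n * g (z0 + of_real t * \<delta>)))" for t :: real
    have "isCont g z0"
      using n by (metis centre_in_ball continuous_on_eq_continuous_at holomorphic_on_imp_continuous_on open_ball)
    then have "isCont (\<lambda>t. g (z0 + complex_of_real t * \<delta>)) 0"
      by (intro isCont_o2[where f = "\<lambda>t. z0 + complex_of_real t * \<delta>" and g = g] continuous_intros) simp
    then have "isCont P 0" unfolding P_def
      by (rule continuous_Re[OF continuous_mult[OF continuous_const continuous_mult[OF continuous_const]]])
    moreover have "P 0 > 0"
    proof -
      have "cnj (f z0) * (\<delta> ^ n * g z0) = of_real ((cmod (f z0))\<^sup>2 * (cmod (g z0))\<^sup>2)"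
        unfolding \<delta> of_real_mult complex_norm_square by (simp add: mult_ac)
      then have "P 0 = (cmod (f z0))\<^sup>2 * (cmod (g z0))\<^sup>2" unfolding P_def by simp
      then show ?thesis using z0(2) g(2)[of z0] n by simp
    qed
    ultimately have "\<forall>\<^sub>F t in at 0. P t > 0"
      by (metis isCont_def order_tendstoD(1))
    then obtain s where s: "s > 0" "\<And>t. t \<noteq> 0 \<Longrightarrow> \<bar>t\<bar> < s \<Longrightarrow> P t > 0"
      by (auto simp: eventually_at dist_real_def)
    \<comment> \<open>Short enough for \<open>P\<close> to stay positive and for the segment to stay
      in the ball; the \<open>+ 1\<close> keeps the denominator positive without a separate argument
      about \<delta>.\<close>
    define t where "t = min (s / 2) (r / (2 * (cmod \<delta> + 1)))"
    have dpos: "cmod \<delta> + 1 > 0" using norm_ge_zero[of \<delta>] by linarith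
    have "t \<le> s / 2" unfolding t_def by (rule min.cobounded1)
    then have t: "0 < t" "t < s" using s n dpos by (auto simp: t_def)
    have tr: "t * cmod \<delta> < r"
    proof -
      have "t * cmod \<delta> \<le> r / (2 * (cmod \<delta> + 1)) * cmod \<delta>"
        by (intro mult_right_mono) (auto simp: t_def)
      also have "\<dots> < r" using dpos n by (simp add: field_simps) (smt (verit) mult_nonneg_nonneg norm_ge_zero)
      finally show ?thesis .
    qed
    have up: "c < cmod (f (z0 + of_real t' * \<delta>))" "z0 + of_real t' * \<delta> \<in> ball z0 r" if "0 < t'" "t' \<le> t" for t'
    proof -
      have "t' * cmod \<delta> \<le> t * cmod \<delta>" using that by (intro mult_right_mono) auto
      then show b: "z0 + of_real t' * \<delta> \<in> ball z0 r" using tr that by (simp add: dist_norm norm_mult)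
      define q where "q = of_real (t' ^ n) * (\<delta> ^ n * g (z0 + of_real t' * \<delta>))"
      have "f (z0 + of_real t' * \<delta>) = f z0 + q"
        using g(1)[OF b] by (simp add: q_def power_mult_distrib algebra_simps)
      moreover have pos: "Re (cnj (f z0) * q) > 0"
      proof -
        have "cnj (f z0) * q = of_real (t' ^ n) * (cnj (f z0) * (\<delta> ^ n * g (z0 + of_real t' * \<delta>)))"
          by (simp only: q_def mult_ac)
        then have "Re (cnj (f z0) * q) = t' ^ n * P t'" unfolding P_def
            by (simp only: times_complex.simps(1)[of "of_real _"] Re_complex_of_real Im_complex_of_real mult_zero_left diff_zero) 
        then show ?thesis using s(2)[of t'] t that by simp
      qed
      \<comment> \<open>The cross term is positive by \<open>pos\<close>, so the modulus strictly
        exceeds \<open>c\<close>.\<close>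
      moreover have "(cmod (f z0 + q))\<^sup>2 = c\<^sup>2 + 2 * Re (cnj (f z0) * q) + (cmod q)\<^sup>2"
        unfolding c_def cmod_power2 by (simp add: power2_eq_square algebra_simps)
      ultimately have "c\<^sup>2 < (cmod (f (z0 + of_real t' * \<delta>)))\<^sup>2"
        using zero_le_power2[of "cmod q"] by (simp only:)
      then show "c < cmod (f (z0 + of_real t' * \<delta>))" by (rule power2_less_imp_less) simp
    qed
    define z1 where "z1 = z0 + of_real t * \<delta>"
    have "closed_segment z0 z1 \<subseteq> S"
    proof
      fix y assume "y \<in> closed_segment z0 z1"
      then obtain v where v: "0 \<le> v" "v \<le> 1" "y = z0 + of_real (v * t) * \<delta>"
        by (auto simp: closed_segment_def z1_def scaleR_conv_of_real algebra_simps)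
      show "y \<in> S"
      proof (cases "v = 0")
        case True then show ?thesis using v z0 by (simp add: S_def c_def)
      next
        case False
        then have "0 < v * t" "v * t \<le> t" using v t by auto
        from up[OF this] show ?thesis using v n(3) C(3) by (auto simp: S_def)
      qed
    qed
    then have p1: "path_component S z0 z1"
      by (meson convex_closed_segment convex_imp_path_connected ends_in_segment path_component_of_subset path_connected_component)
    \<comment> \<open>The strict superlevel set is open, so its components are open and
      path-connected; the segment already reaches it at \<open>z1\<close>.\<close>
    define W where "W = {z\<in>\<Omega>. c < cmod (f z)}"
    have "W = \<Omega> \<inter> (\<lambda>z. cmod (f z)) -` {c<..}" by (auto simp: W_def)
    moreover have "continuous_on \<Omega> (\<lambda>z. cmod (f z))" by (intro continuous_intros cont)
    ultimately have W: "open W" using \<open>open \<Omega>\<close> by (metis continuous_openin_preimage_gen open_greaterThan openin_open_eq continuous_on_open_vimage Int_commute)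
    have z1: "z1 \<in> W" using up[of t] t n(3) C(3) by (auto simp: W_def z1_def)
    define D where "D = connected_component_set W z1"
    have D: "open D" "z1 \<in> D" "D \<subseteq> W" using W z1 by (auto simp: D_def open_connected_component connected_component_subset)
    \<comment> \<open>If \<open>D\<close> missed \<open>U\<close>, it would be bounded by the decay
      of \<open>f\<close>, with \<bar>f\<bar> \<le> c on its frontier; the maximum principle then
      contradicts \<bar>f\<bar> > c at \<open>z1\<close>.\<close>
    have "D \<inter> U \<noteq> {}"
    proof
      assume "D \<inter> U = {}"
      then have cl: "closure D \<subseteq> \<Omega>" by (rule disj)
      obtain B where "\<forall>z\<in>\<Omega>. cmod z > B \<longrightarrow> cmod (f z) < c" using decay[OF c] by blast
      then have "bounded D" using D(3) unfolding bounded_iff W_def by (intro exI[of _ B]) force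
      moreover have "f holomorphic_on interior D"
        by (meson hol cl closure_subset holomorphic_on_subset interior_subset subset_trans)
      moreover have "continuous_on (closure D) f" using cont cl continuous_on_subset by blast
      moreover have "cmod (f z) \<le> c" if "z \<in> frontier D" for z
      proof -
        have "z \<in> \<Omega>" "z \<notin> W"
          using that cl frontier_component[OF W, of z1] by (auto simp: D_def frontier_def)
        then show ?thesis by (simp add: W_def)
      qed
      ultimately have "cmod (f z1) \<le> c"
        using maximum_modulus_frontier[of f D c z1] D(2) by blast
      then show False using z1 by (simp add: W_def)
    qed
    then obtain w where w: "w \<in> D" "w \<in> U" by blast
    have "path_component W z1 w"
      using w(1) path_component_eq_connected_component_set[OF open_imp_locally_path_connected[OF W], of z1]
      unfolding D_def by blast
    then have "path_component S z1 w"
      by (rule path_component_of_subset[rotated]) (auto simp: W_def S_def)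
    then show ?thesis using p1 w(2) path_component_trans by blast
  qed
  then show ?thesis using that unfolding S_def c_def by blast
qed

section \<open>Periodic Jacobi operators with constant off-diagonals\<close>

text \<open>Passing from the Laurent operator to \<open>J\<close> costs at most \<omega> in the
  lower bound. The adjoint of \<open>z I - J\<close> obeys the same bound, which supplies
  invertibility.\<close>

lemma jacobi_laurent_perturbation:
  fixes \<alpha> \<beta> \<gamma> :: real
  assumes a: "periodic_seq p a" "p > 0" and \<omega>: "\<And>n. \<bar>a n - \<alpha>\<bar> \<le> \<omega>"
    and d: "\<And>x :: complex. cmod x = 1 \<Longrightarrow> d \<le> cmod (z - (\<alpha> + \<beta> * x + \<gamma> * cnj x))" "\<omega> < d"
  defines "J \<equiv> jacobi a (\<lambda>_. \<beta>) (\<lambda>_. \<gamma>)"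
  shows "z \<notin> op_spectrum J" "onorm (resolvent_op J z) \<le> 1 / (d - \<omega>)"
proof -
  have \<omega>0: "0 \<le> \<omega>" using \<omega>[of 0] by linarith
  \<comment> \<open>Stated for arbitrary \<open>z\<close>, \<beta> and \<gamma>, because it is used
    again for the adjoint, at \<open>cnj z\<close> with the off-diagonals exchanged.\<close>
  have below: "(d - \<omega>) * norm u \<le> norm (scaleC z u - jacobi a (\<lambda>_. \<beta>) (\<lambda>_. \<gamma>) u)"
    if d: "\<And>x :: complex. cmod x = 1 \<Longrightarrow> d \<le> cmod (z - (\<alpha> + \<beta> * x + \<gamma> * cnj x))" for u z \<beta> \<gamma>
  proof -
    let ?T = "jacobi (\<lambda>_. \<alpha>) (\<lambda>_. \<beta>) (\<lambda>_. \<gamma>)" and ?J = "jacobi a (\<lambda>_. \<beta>) (\<lambda>_. \<gamma>)"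
    have "d * norm u \<le> norm (scaleC z u - ?T u)"
      using \<omega>0 \<open>\<omega> < d\<close> by (intro laurent_bounded_below d) auto
    also have "\<dots> = norm ((scaleC z u - ?J u) + (?J u - ?T u))" by simp
    also have "\<dots> \<le> norm (scaleC z u - ?J u) + norm (?J u - ?T u)" by (rule norm_triangle_ineq)
    also have "norm (?J u - ?T u) \<le> \<omega> * norm u"
      by (rule norm_jacobi_diff_le[OF a(1) _ _ _ a(2) \<omega>]) (rule periodic_seq_const)+
    finally show ?thesis by (simp add: left_diff_distrib)
  qed
  have bc: "bounded_clinear (jacobi a (\<lambda>_. \<beta>) (\<lambda>_. \<gamma>))" for \<beta> \<gamma>
    by (rule bounded_clinear_jacobi[OF a(1) _ _ a(2)]) (rule periodic_seq_const)+
  have cnj_d: "d \<le> cmod (cnj z - (\<alpha> + \<gamma> * x + \<beta> * cnj x))" if "cmod x = 1" for x :: complex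
  proof -
    have "cnj z - (\<alpha> + \<gamma> * x + \<beta> * cnj x) = cnj (z - (\<alpha> + \<beta> * x + \<gamma> * cnj x))" by (simp add: algebra_simps)
    then show ?thesis using d(1)[OF that] by (metis complex_mod_cnj)
  qed
  have adj: "inner (scaleC z u - J u) v = inner u (scaleC (cnj z) v - jacobi a (\<lambda>_. \<gamma>) (\<lambda>_. \<beta>) v)" for u v
  proof -
    have "cinner (scaleC z u) v = cinner u (scaleC (cnj z) v)"
      by (metis cinner_commute cinner_scaleC_right complex_cnj_cnj complex_cnj_mult)
    moreover have "cinner (J u) v = cinner u (jacobi a (\<lambda>_. \<gamma>) (\<lambda>_. \<beta>) v)"
      unfolding J_def by (rule cinner_jacobi[OF a(1) _ _ a(2)]) (rule periodic_seq_const)+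
    ultimately show ?thesis
      unfolding inner_diff_left inner_diff_right by (simp flip: Re_cinner)
  qed
  have below_J: "(d - \<omega>) * norm u \<le> norm (scaleC z u - J u)" for u
    unfolding J_def by (rule below[OF d(1)])
  have "bij (\<lambda>u. scaleC z u - J u)"
    by (rule bij_of_bounded_below_adjoint[where d = "d - \<omega>", OF _ _ adj])
      (use \<open>\<omega> < d\<close> below_J below[OF cnj_d] bc in \<open>auto simp: J_def intro: bounded_linear_shifted\<close>)
  from resolvent_bounded_below[OF bc[of \<beta> \<gamma>, folded J_def] this _ below_J]
  show "z \<notin> op_spectrum J" "onorm (resolvent_op J z) \<le> 1 / (d - \<omega>)"
    using \<open>\<omega> < d\<close> by auto
qed

theorem theorem3p3:
  fixes p :: nat and a b c :: "int \<Rightarrow> real"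
  assumes "p > 0"
    and "periodic_seq p a" and "periodic_seq p b" and "periodic_seq p c"
    and "\<forall>i\<in>{0..<int p}. b i = b 0"
    and "\<forall>i\<in>{0..<int p}. c i = c 0"
  shows "path_connected (pseudospectrum (3 * omega0 a) (jacobi a b c))"
proof -
  define \<alpha> where "\<alpha> = a 0"
  define \<beta> where "\<beta> = b 0"
  define \<gamma> where "\<gamma> = c 0"
  define \<omega> where "\<omega> = omega0 a"
  define J where "J = jacobi a (\<lambda>_. \<beta>) (\<lambda>_. \<gamma>)"
  define \<Lambda> where "\<Lambda> = pseudospectrum (3 * \<omega>) J"
  have mod: "n mod int p \<in> {0..<int p}" for n using assms(1) by simp
  have "b n = \<beta>" "c n = \<gamma>" for n
    unfolding \<beta>_def \<gamma>_def using assms(3-6) mod[of n] by (metis periodic_seq_mod)+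
  then have "b = (\<lambda>_. \<beta>)" "c = (\<lambda>_. \<gamma>)" by auto
  then have J: "jacobi a b c = J" by (simp add: J_def)
  \<comment> \<open>The maximum in \<open>omega0\<close> runs over nonnegative indices only;
    reduction modulo \<open>p\<close> covers the negative ones.\<close>
  have \<omega>: "\<bar>a n - \<alpha>\<bar> \<le> \<omega>" for n
  proof -
    have "\<bar>a n - \<alpha>\<bar> = \<bar>a (n mod int p) - a 0\<bar>"
      using periodic_seq_mod[OF assms(2), of n] by (simp add: \<alpha>_def)
    also have "\<dots> \<in> {\<bar>a i - a 0\<bar> | i. 0 \<le> i}" using mod[of n] by auto
    finally show ?thesis
      unfolding \<omega>_def omega0_def by (intro Max_ge finite_omega0_set[OF assms(2,1)])
  qed
  then have \<omega>0: "0 \<le> \<omega>" using \<omega>[of 0] by linarith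
  have bc: "bounded_clinear J"
    unfolding J_def by (rule bounded_clinear_jacobi[OF assms(2) _ _ assms(1)]) (rule periodic_seq_const)+

  define m where "m x = \<alpha> + \<beta> * x + \<gamma> * cnj x" for x :: complex
  define E where "E = m ` sphere 0 1"
  have m: "continuous_on S m" for S unfolding m_def by (intro continuous_intros)
  have E: "compact E" "path_connected E" "E \<noteq> {}"
    unfolding E_def by (auto intro!: compact_continuous_image path_connected_continuous_image m path_connected_sphere)
  define \<Omega> where "\<Omega> = {z. \<omega> < infdist z E}"
  have \<Omega>: "z \<notin> op_spectrum J" "onorm (resolvent_op J z) \<le> 1 / (infdist z E - \<omega>)" if "z \<in> \<Omega>" for z
  proof -
    have "infdist z E \<le> cmod (z - (\<alpha> + \<beta> * x + \<gamma> * cnj x))" if "cmod x = 1" for x :: complex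
      using that infdist_le[of "m x" E z] by (simp add: E_def m_def dist_norm)
    from jacobi_laurent_perturbation[OF assms(2,1) \<omega> this, folded J_def]
    show "z \<notin> op_spectrum J" "onorm (resolvent_op J z) \<le> 1 / (infdist z E - \<omega>)"
      using \<open>z \<in> \<Omega>\<close> by (simp_all add: \<Omega>_def)
  qed
  \<comment> \<open>The budget of 3\<omega>: 2\<omega> for the distance from \<open>z\<close> to
    \<open>e\<close> and \<omega> for the diagonal perturbation; what \<eta> has beyond that pays
    for the approximate eigenvector. The non-strict bound also serves the case \<omega> = 0.\<close>
  have near: "z \<in> \<Lambda>" if e: "e \<in> E" "cmod (z - e) \<le> 2 * \<omega>" for z e
    unfolding \<Lambda>_def
  proof (rule pseudospectrum_approx_eigenvector[OF _ bc])
    fix \<eta> assume "3 * \<omega> < \<eta>"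
    obtain x where x: "cmod x = 1" "e = m x" using e(1) by (auto simp: E_def)
    let ?T = "jacobi (\<lambda>_. \<alpha>) (\<lambda>_. \<beta>) (\<lambda>_. \<gamma>)"
    obtain u where u: "u \<noteq> 0" "norm (scaleC e u - ?T u) \<le> (\<eta> - 3 * \<omega>) * norm u"
      unfolding x(2) m_def
      by (rule laurent_approx_eigenvector[OF x(1), of "\<eta> - 3 * \<omega>" \<alpha> \<beta> \<gamma>])
        (use \<open>3 * \<omega> < \<eta>\<close> in auto)
    have TJ: "norm (J u - ?T u) \<le> \<omega> * norm u"
      unfolding J_def by (rule norm_jacobi_diff_le[OF assms(2) _ _ _ assms(1) \<omega>]) (rule periodic_seq_const)+
    have "scaleC z u - J u = scaleC (z - e) u + (scaleC e u - ?T u) - (J u - ?T u)"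
      by (simp add: scaleC_diff_left)
    also have "norm \<dots> \<le> norm (scaleC (z - e) u) + norm (scaleC e u - ?T u) + norm (J u - ?T u)"
      by (meson add_mono norm_triangle_ineq norm_triangle_ineq4 order_refl order_trans)
    also have "\<dots> \<le> 2 * \<omega> * norm u + (\<eta> - 3 * \<omega>) * norm u + \<omega> * norm u"
      unfolding norm_scaleC by (intro add_mono u TJ mult_right_mono e) auto
    also have "\<dots> = \<eta> * norm u" by (simp add: algebra_simps)
    finally show "\<exists>u. u \<noteq> 0 \<and> norm (scaleC z u - J u) \<le> \<eta> * norm u" using u(1) by blast
  qed (use \<omega>0 in simp)

  have "path_connected \<Lambda>"
  \<comment> \<open>For \<omega> = 0 the pseudospectrum is the spectrum, and it coincides with the
    curve \<open>E\<close>.\<close>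
  proof (cases "\<omega> = 0")
    case True
    have "\<Lambda> \<subseteq> E"
    proof
      fix z assume "z \<in> \<Lambda>"
      then have "z \<notin> \<Omega>" using \<Omega>(1) True by (auto simp: \<Lambda>_def pseudospectrum_def)
      then have "infdist z E = 0" using True infdist_nonneg[of z E] by (simp add: \<Omega>_def)
      then show "z \<in> E" using E in_closed_iff_infdist_zero compact_imp_closed by blast
    qed
    moreover have "E \<subseteq> \<Lambda>" using near True by auto
    ultimately show ?thesis using E(2) by (metis subset_antisym)
  next
    case False
    then have pos: "\<omega> > 0" using \<omega>0 by simp
    define U where "U = (\<Union>e\<in>E. ball e (2 * \<omega>))"
    have "open U" by (auto simp: U_def)
    have U\<Lambda>: "U \<subseteq> \<Lambda>"
      using near by (auto simp: U_def dist_norm norm_minus_commute intro: less_imp_le)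
    \<comment> \<open>A point outside \<Omega> is within \<omega> < 2\<omega> of the curve, hence in
      \<open>U\<close>.\<close>
    have cover: "\<Omega> \<union> U = UNIV"
    proof -
      have "z \<in> U" if z: "z \<notin> \<Omega>" for z
      proof -
        obtain e where "e \<in> E" "infdist z E = dist z e"
          using infdist_attains_inf[of E z] E compact_imp_closed by metis
        then show ?thesis
          using z pos by (auto simp: \<Omega>_def U_def dist_commute intro!: bexI[of _ e])
      qed
      then show ?thesis by blast
    qed
    have "continuous_on UNIV (\<lambda>z. infdist z E)" by (intro continuous_on_infdist continuous_on_id)
    then have "open \<Omega>" unfolding \<Omega>_def by (intro open_Collect_less continuous_on_const)
    obtain b where b: "\<And>e. e \<in> E \<Longrightarrow> cmod e \<le> b"
      using E(1) compact_imp_bounded bounded_iff by metis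
    have infdist_ge: "cmod z - b \<le> infdist z E" for z
    proof -
      obtain e where "e \<in> E" "infdist z E = dist z e"
        using infdist_attains_inf[of E z] E compact_imp_closed by metis
      then show ?thesis using b[of e] norm_triangle_ineq2[of z e] by (simp add: dist_norm)
    qed
    have to_U: "\<exists>w\<in>U. path_component \<Lambda> z0 w" if z0: "z0 \<in> \<Lambda>" for z0
    proof (cases "z0 \<in> U")
      case True
      then show ?thesis using z0 path_component_refl by blast
    next
      case False
      then have z0\<Omega>: "z0 \<in> \<Omega>" using cover by blast
      then have on: "1 / (3 * \<omega>) \<le> onorm (resolvent_op J z0)"
        using z0 \<Omega>(1) pos by (auto simp: \<Lambda>_def pseudospectrum_def)
      have spec: "\<Omega> \<inter> op_spectrum J = {}" using \<Omega>(1) by blast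
      have g: "continuous_on \<Omega> (\<lambda>z. 1 / (infdist z E - \<omega>))"
        by (intro continuous_intros) (auto simp: \<Omega>_def)
      have "3 * \<omega> > 0" using pos by simp
      obtain f where f: "f holomorphic_on \<Omega>" "\<And>z. z \<in> \<Omega> \<Longrightarrow> cmod (f z) \<le> onorm (resolvent_op J z)"
        "1 / (3 * \<omega>) \<le> cmod (f z0)"
        using holomorphic_minorant_of_onorm_resolvent[OF bc \<open>open \<Omega>\<close> spec g \<Omega>(2) z0\<Omega> on \<open>3 * \<omega> > 0\<close>]
        by blast
      \<comment> \<open>Far from the curve \<open>f\<close> is dominated by the resolvent bound,
        which is below \<open>e\<close> once the distance exceeds \<omega> + 1/e; the constant
        \<open>b\<close> turns this into a condition on \<open>cmod z\<close>.\<close>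
      have decay: "\<exists>B. \<forall>z\<in>\<Omega>. cmod z > B \<longrightarrow> cmod (f z) < e" if "e > 0" for e
      proof (intro exI ballI impI)
        fix z assume z: "z \<in> \<Omega>" "b + \<omega> + 1 / e < cmod z"
        then have i: "1 / e < infdist z E - \<omega>" using infdist_ge[of z] by linarith
        have "cmod (f z) \<le> 1 / (infdist z E - \<omega>)" using f(2) \<Omega>(2) z(1) order_trans by blast
        also have "\<dots> < e" using i that z(1) by (simp add: \<Omega>_def field_simps)
        finally show "cmod (f z) < e" .
      qed
      have "f z0 \<noteq> 0" using f(3) pos by (auto simp: field_simps)
      then obtain w where w: "w \<in> U" "path_component ({z\<in>\<Omega>. cmod (f z0) \<le> cmod (f z)} \<union> U) z0 w"
        using escape_to_neighbourhood_of_complement[OF f(1) \<open>open \<Omega>\<close> \<open>open U\<close> cover decay z0\<Omega>] by blast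
      \<comment> \<open>As \<bar>f\<bar> is at most the resolvent norm and at least 1/(3\<omega>) at
        \<open>z0\<close>, its superlevel set satisfies the pseudospectral inequality.\<close>
      have "{z\<in>\<Omega>. cmod (f z0) \<le> cmod (f z)} \<union> U \<subseteq> \<Lambda>"
      proof -
        have "z \<in> \<Lambda>" if "z \<in> \<Omega>" "cmod (f z0) \<le> cmod (f z)" for z
          using f(2)[OF that(1)] f(3) that(2) \<Omega>(1)[OF that(1)] pos
          by (simp add: \<Lambda>_def pseudospectrum_def)
        then show ?thesis using U\<Lambda> by blast
      qed
      then show ?thesis using w path_component_of_subset by blast
    qed
    \<comment> \<open>Each ball of \<open>U\<close> contains a straight path to its centre, and
      \<open>E\<close> itself is path-connected, so every point is finally joined through the
      curve.\<close>
    have to_E: "\<exists>e\<in>E. path_component \<Lambda> w e" if "w \<in> U" for w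
    proof -
      obtain e where e: "e \<in> E" "w \<in> ball e (2 * \<omega>)" using \<open>w \<in> U\<close> by (auto simp: U_def)
      have "path_component (ball e (2 * \<omega>)) w e"
        using convex_imp_path_connected[OF convex_ball] e(2) pos
        by (metis centre_in_ball mult_pos_pos path_connected_component zero_less_numeral)
      moreover have "ball e (2 * \<omega>) \<subseteq> \<Lambda>" using U\<Lambda> e(1) by (auto simp: U_def)
      ultimately show ?thesis using e(1) path_component_of_subset by blast
    qed
    have "E \<subseteq> \<Lambda>" using near pos by auto
    show ?thesis unfolding path_connected_component
    proof (intro ballI)
      fix x y assume "x \<in> \<Lambda>" "y \<in> \<Lambda>"
      then obtain e e' where e: "e \<in> E" "path_component \<Lambda> x e" "e' \<in> E" "path_component \<Lambda> y e'"
        using to_U to_E path_component_trans by metis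
      then have "path_component \<Lambda> e e'"
        using E(2) \<open>E \<subseteq> \<Lambda>\<close> path_component_of_subset unfolding path_connected_component by blast
      then show "path_component \<Lambda> x y" using e path_component_trans path_component_sym by metis
    qed
  qed
  then show ?thesis by (simp add: J \<Lambda>_def \<omega>_def)
qed

end
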